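(* Let $G$ be a finite subgroup of $\mathrm{PSU}_2(\mathbb{C})$ acting on $\mathbb{P}^1=\mathbb{P}^1(\mathbb{C})$ by homographies and let $n\geq1$. There exists a unique holomorphic $1$-form $\omega$ on $\mathrm{Cf}_G(n,\mathbb{P}^1_* )$ with values in $\widehat{\mathrm{U}}\mathfrak{p}_n(G)(\mathbb{C})$ whose restriction to $U:=(\mathbb{P}^1\setminus\{\infty\})^n\cap\mathrm{Cf}_G(n,\mathbb{P}^1_* )$ is $$\omega_{|U}=\sum_{i\in[1,n]}\ \sum_{p\in\mathbb{P}^1\setminus\mathbb{P}^1_*}d\log(z_i-p)\,\widehat{\otimes}\,X_i(p)+\sum_{i\neq j\in[1,n]}\ \sum_{g\in G}d_{z_i}\log(z_i-g\cdot z_j)\,\widehat{\otimes}\,X_{ij}(g),$$ where one sets $d\log(z-\infty)=0$.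
   Context: Notation: $[1,n]=\{1,\dots,n\}$; $\mathbb{P}^1_*$ is the set of points of $\mathbb{P}^1$ with trivial stabilizer in $G$; $\mathcal{O}(p)$ and $\mathrm{stab}(p)$ are the $G$-orbit and the stabilizer of $p$; $\mathrm{Cf}_G(n,\mathbb{P}^1_* )=\{(p_1,\dots,p_n)\in(\mathbb{P}^1_* )^n \mid p_i\neq g\cdot p_j \text{ for all } i\neq j,\ g\in G\}$, a complex manifold; $z_1,\dots,z_n$ are the standard coordinates on $U$; $d_{z_i}\log(z_i-g\cdot z_j)=dz_i/(z_i-g\cdot z_j)$ is the $dz_i$-part of the logarithmic differential. $\mathfrak{p}_n(G)(\mathbb{C})$ is the $\mathbb{C}$-Lie algebra with generators $X_{ij}(g)$ ($i\neq j\in[1,n]$, $g\in G$) and $X_i(q)$ ($i\in[1,n]$, $q\in\mathbb{P}^1\setminus\mathbb{P}^1_*$) and relations: (1) $X_{ij}(g)=X_{ji}(g^{-1})$ for $i\ne j$, $g\in G$; (2) $\sum_{q\in\mathbb{P}^1\setminus\mathbb{P}^1_*}X_i(q)+\sum_{m\neq i}\sum_{g\in G}X_{im}(g)=0$ for $i\in[1,n]$; (3) $[X_{ij}(g),X_{kl}(g')]=0$ for $i,j,k,l$ distinct, $g,g'\in G$; (4) $[X_{ij}(g),X_{kj}(g'g)+X_{ki}(g')]=0$ and $[X_i(p),X_{jk}(g')]=0$ for $i,j,k$ distinct, $p\in\mathbb{P}^1\setminus\mathbb{P}^1_*$, $g,g'\in G$; and, for $i\neq j$, $g\in G$, $p\in\mathbb{P}^1\setminus\mathbb{P}^1_*$,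 $q\in(\mathbb{P}^1\setminus\mathbb{P}^1_* )\setminus\mathcal{O}(p)$: (5) $[X_i(p),X_j(q)]=0$; (6) $[X_{ij}(g),X_j(p)+X_i(g\cdot p)+\sum_{h\in\mathrm{stab}(p)}X_{ij}(gh)]=0$; (7) $[X_j(p),X_i(g\cdot p)+\sum_{h\in\mathrm{stab}(p)}X_{ij}(gh)]=0$. It is graded with generators in degree $1$; $\widehat{\mathrm{U}}\mathfrak{p}_n(G)(\mathbb{C})$ is the completion of its enveloping algebra for the degree. For a complete graded algebra $A=\prod_{k\ge0}A_k$ with finite-dimensional components and a complex manifold $X$, holomorphic forms on $X$ with values in $A$ are elements of $\Omega^\bullet(X)\widehat{\otimes}A$, the completion of $\Omega^\bullet(X)\otimes_{\mathbb{C}}A$ for the filtration $\Omega^\bullet(X)\otimes A_{\geq k}$, where $\Omega^\bullet(X)$ is the algebra of holomorphic forms. *)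

theory Defs
  imports
    "HOL-Analysis.Analysis"
    "HOL-Library.Poly_Mapping"
    "HOL-Algebra.QuotRing"
    "HOL-Algebra.Module"
    "HOL-Algebra.Group_Action"
begin

section \<open>The group \<open>PSU\<^sub>2(\<complex>)\<close> and its action on the projective line\<close>

definition conj_transpose :: "complex^2^2 \<Rightarrow> complex^2^2" where
  "conj_transpose A = (\<chi> i j. cnj (A $ j $ i))"

definition SU2 :: "(complex^2^2) monoid" where
  "SU2 = \<lparr>carrier = {A. A ** conj_transpose A = mat 1 \<and> det A = 1}, mult = (**), one = mat 1\<rparr>"

type_synonym psu2 = "(complex^2^2) set"

definition PSU2 :: "psu2 monoid" where
  "PSU2 = SU2 Mod {mat 1, - mat 1}"

datatype p1 = Fin complex | Inf

definition homography :: "complex^2^2 \<Rightarrow> p1 \<Rightarrow> p1" where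
  "homography A p = (case p of
      Fin z \<Rightarrow> (if A$2$1 * z + A$2$2 = 0 then Inf
                else Fin ((A$1$1 * z + A$1$2) / (A$2$1 * z + A$2$2)))
    | Inf \<Rightarrow> (if A$2$1 = 0 then Inf else Fin (A$1$1 / A$2$1)))"

text \<open>The two representatives of an element of \<open>PSU\<^sub>2(\<complex>)\<close> define the same homography
  (lemma \<open>psu2_act_eq\<close> below).\<close>

definition psu2_act :: "psu2 \<Rightarrow> p1 \<Rightarrow> p1" where
  "psu2_act g p = homography (SOME A. A \<in> g) p"

lemma homography_uminus: "homography (- A) p = homography A p"
proof (cases p)
  case (Fin z)
  have "(- A)$2$1 * z + (- A)$2$2 = - (A$2$1 * z + A$2$2)"
    and "(- A)$1$1 * z + (- A)$1$2 = - (A$1$1 * z + A$1$2)" by simp_all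
  then show ?thesis using Fin
    by (simp only: homography_def p1.case) (simp only: minus_divide_divide neg_equal_0_iff_equal)
qed (simp add: homography_def)

lemma PSU2_carrier_cases:
  assumes "g \<in> carrier PSU2"
  obtains A where "A \<in> carrier SU2" "g = {A, - A}"
proof -
  have neg: "(- mat 1) ** A = - A" for A :: "complex^2^2"
    by (simp add: matrix_matrix_mult_def mat_def vec_eq_iff sum_2 forall_2)
  from assms obtain A where "A \<in> carrier SU2" "g = {mat 1, - mat 1} #>\<^bsub>SU2\<^esub> A"
    by (auto simp: PSU2_def FactGroup_def RCOSETS_def)
  with that[of A] neg[of A] show thesis
    by (auto simp: r_coset_def SU2_def)
qed

lemma psu2_act_eq:
  assumes "g \<in> carrier PSU2" "A \<in> g"
  shows "psu2_act g p = homography A p"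
proof -
  obtain B where B: "g = {B, - B}" using PSU2_carrier_cases[OF assms(1)] by blast
  have "(SOME C. C \<in> g) \<in> g" using assms(2) by (rule someI)
  then show ?thesis using B assms(2) homography_uminus
    by (auto simp: psu2_act_def)
qed

abbreviation subgrp :: "psu2 set \<Rightarrow> psu2 monoid" where
  "subgrp G \<equiv> PSU2\<lparr>carrier := G\<rparr>"

definition stab :: "psu2 set \<Rightarrow> p1 \<Rightarrow> psu2 set" where
  "stab G p = stabilizer (subgrp G) psu2_act p"

definition orb :: "psu2 set \<Rightarrow> p1 \<Rightarrow> p1 set" where
  "orb G p = orbit (subgrp G) psu2_act p"

definition P1_star :: "psu2 set \<Rightarrow> p1 set" where
  "P1_star G = {p. stab G p = {\<one>\<^bsub>PSU2\<^esub>}}"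

text \<open>The index set \<open>[1,n]\<close> is a finite type \<open>'n\<close>, so that \<open>n = CARD('n) \<ge> 1\<close>.\<close>

definition Cf :: "psu2 set \<Rightarrow> ('n \<Rightarrow> p1) set" where
  "Cf G = {p. (\<forall>i. p i \<in> P1_star G) \<and> (\<forall>i j. i \<noteq> j \<longrightarrow> (\<forall>g\<in>G. p i \<noteq> psu2_act g (p j)))}"

definition Cf_affine :: "psu2 set \<Rightarrow> ('n \<Rightarrow> p1) set" where
  "Cf_affine G = {p \<in> Cf G. \<forall>i. p i \<noteq> Inf}"

section \<open>Complex vector spaces and algebras, as \<open>module\<close> records\<close>

definition CC :: "complex ring" where
  "CC = \<lparr>carrier = UNIV, mult = (*), one = 1, zero = 0, add = (+)\<rparr>"

definition quot_module :: "(complex, 'a) module \<Rightarrow> 'a set \<Rightarrow> (complex, 'a set) module" where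
  "quot_module M N =
     ring.extend (M Quot N) \<lparr>smult = (\<lambda>c X. \<Union>x\<in>X. N +>\<^bsub>M\<^esub> (c \<odot>\<^bsub>M\<^esub> x))\<rparr>"

definition alg_ideal :: "(complex, 'a) module \<Rightarrow> 'a set \<Rightarrow> bool" where
  "alg_ideal M I \<longleftrightarrow> submodule I CC M \<and>
     (\<forall>x\<in>carrier M. \<forall>a\<in>I. x \<otimes>\<^bsub>M\<^esub> a \<in> I \<and> a \<otimes>\<^bsub>M\<^esub> x \<in> I)"

definition alg_presented :: "(complex, 'a) module \<Rightarrow> 'a set \<Rightarrow> (complex, 'a set) module" where
  "alg_presented M R = quot_module M (alg_ideal M hull R)"

definition alg_class :: "(complex, 'a) module \<Rightarrow> 'a set \<Rightarrow> 'a \<Rightarrow> 'a set" where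
  "alg_class M R x = (alg_ideal M hull R) +>\<^bsub>M\<^esub> x"

text \<open>\<open>'k \<Rightarrow>\<^sub>0 complex\<close> is the complex vector space with basis \<open>'k\<close>.\<close>

abbreviation basis :: "'k \<Rightarrow> ('k \<Rightarrow>\<^sub>0 complex)" where
  "basis k \<equiv> Poly_Mapping.single k 1"

definition scale :: "complex \<Rightarrow> ('k \<Rightarrow>\<^sub>0 complex) \<Rightarrow> ('k \<Rightarrow>\<^sub>0 complex)" where
  "scale c f = Poly_Mapping.map ((*) c) f"

definition bilinear_ext :: "('k \<Rightarrow> 'k \<Rightarrow> 'k) \<Rightarrow> ('k \<Rightarrow>\<^sub>0 complex) \<Rightarrow> ('k \<Rightarrow>\<^sub>0 complex) \<Rightarrow> ('k \<Rightarrow>\<^sub>0 complex)" where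
  "bilinear_ext m f g = (\<Sum>s\<in>Poly_Mapping.keys f. \<Sum>t\<in>Poly_Mapping.keys g.
     Poly_Mapping.single (m s t) (Poly_Mapping.lookup f s * Poly_Mapping.lookup g t))"

definition free_module :: "'k set \<Rightarrow> (complex, 'k \<Rightarrow>\<^sub>0 complex) module" where
  "free_module K = \<lparr>carrier = {f. Poly_Mapping.keys f \<subseteq> K}, mult = undefined, one = undefined,
     zero = 0, add = (+), smult = scale\<rparr>"

section \<open>Presented Lie algebras\<close>

datatype 'x magma = Leaf 'x | Node "'x magma" "'x magma"

fun leaves :: "'x magma \<Rightarrow> nat" where
  "leaves (Leaf x) = 1"
| "leaves (Node s t) = leaves s + leaves t"

text \<open>The free nonassociative algebra on \<open>X\<close>; its product (the field \<open>mult\<close>) becomes the bracket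
  of the Lie algebras presented by generators \<open>X\<close>.\<close>

definition free_magma_algebra :: "'x set \<Rightarrow> (complex, 'x magma \<Rightarrow>\<^sub>0 complex) module" where
  "free_magma_algebra X = (free_module {t. set_magma t \<subseteq> X})\<lparr>mult := bilinear_ext Node\<rparr>"

definition lie_axioms :: "(complex, 'a) module \<Rightarrow> 'a set" where
  "lie_axioms F =
     {a \<otimes>\<^bsub>F\<^esub> a | a. a \<in> carrier F} \<union>
     {a \<otimes>\<^bsub>F\<^esub> (b \<otimes>\<^bsub>F\<^esub> c) \<oplus>\<^bsub>F\<^esub> b \<otimes>\<^bsub>F\<^esub> (c \<otimes>\<^bsub>F\<^esub> a) \<oplus>\<^bsub>F\<^esub> c \<otimes>\<^bsub>F\<^esub> (a \<otimes>\<^bsub>F\<^esub> b) | a b c.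
        a \<in> carrier F \<and> b \<in> carrier F \<and> c \<in> carrier F}"

definition lie_presented ::
  "'x set \<Rightarrow> ('x magma \<Rightarrow>\<^sub>0 complex) set \<Rightarrow> (complex, ('x magma \<Rightarrow>\<^sub>0 complex) set) module" where
  "lie_presented X R =
     alg_presented (free_magma_algebra X) (lie_axioms (free_magma_algebra X) \<union> R)"

definition lie_class ::
  "'x set \<Rightarrow> ('x magma \<Rightarrow>\<^sub>0 complex) set \<Rightarrow> ('x magma \<Rightarrow>\<^sub>0 complex) \<Rightarrow> ('x magma \<Rightarrow>\<^sub>0 complex) set" where
  "lie_class X R = alg_class (free_magma_algebra X) (lie_axioms (free_magma_algebra X) \<union> R)"

text \<open>The degree \<open>k\<close> part when the generators have degree 1 (for homogeneous relators).\<close>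

definition lie_graded ::
  "'x set \<Rightarrow> ('x magma \<Rightarrow>\<^sub>0 complex) set \<Rightarrow> nat \<Rightarrow> ('x magma \<Rightarrow>\<^sub>0 complex) set set" where
  "lie_graded X R k = lie_class X R ` {f \<in> carrier (free_magma_algebra X).
     \<forall>t\<in>Poly_Mapping.keys f. leaves t = k}"

section \<open>Enveloping algebras and their completion\<close>

definition free_algebra :: "'l set \<Rightarrow> (complex, 'l list \<Rightarrow>\<^sub>0 complex) module" where
  "free_algebra X = (free_module (lists X))\<lparr>mult := bilinear_ext (@), one := basis []\<rparr>"

text \<open>The first two families of relators make the free algebra on the set \<open>carrier L\<close> into the
  tensor algebra of the vector space \<open>L\<close>.\<close>

definition env_relators :: "(complex, 'l) module \<Rightarrow> ('l list \<Rightarrow>\<^sub>0 complex) set" where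
  "env_relators L =
     {basis [x \<oplus>\<^bsub>L\<^esub> y] - basis [x] - basis [y] | x y. x \<in> carrier L \<and> y \<in> carrier L} \<union>
     {basis [c \<odot>\<^bsub>L\<^esub> x] - scale c (basis [x]) | c x. x \<in> carrier L} \<union>
     {basis [x, y] - basis [y, x] - basis [x \<otimes>\<^bsub>L\<^esub> y] | x y. x \<in> carrier L \<and> y \<in> carrier L}"

definition enveloping :: "(complex, 'l) module \<Rightarrow> (complex, ('l list \<Rightarrow>\<^sub>0 complex) set) module" where
  "enveloping L = alg_presented (free_algebra (carrier L)) (env_relators L)"

definition env_class :: "(complex, 'l) module \<Rightarrow> ('l list \<Rightarrow>\<^sub>0 complex) \<Rightarrow> ('l list \<Rightarrow>\<^sub>0 complex) set" where
  "env_class L = alg_class (free_algebra (carrier L)) (env_relators L)"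

text \<open>Grading of the enveloping algebra induced by a grading \<open>Lg\<close> of \<open>L\<close>: degree \<open>k\<close> is spanned
  by the products of homogeneous elements of \<open>L\<close> whose degrees add up to \<open>k\<close>.\<close>

definition env_graded ::
  "(complex, 'l) module \<Rightarrow> (nat \<Rightarrow> 'l set) \<Rightarrow> nat \<Rightarrow> ('l list \<Rightarrow>\<^sub>0 complex) set set" where
  "env_graded L Lg k = env_class L ` {f \<in> carrier (free_algebra (carrier L)).
     \<forall>xs\<in>Poly_Mapping.keys f. \<exists>ds. list_all2 (\<lambda>x d. x \<in> Lg d) xs ds \<and> sum_list ds = k}"

definition graded_completion ::
  "(complex, 'a) module \<Rightarrow> (nat \<Rightarrow> 'a set) \<Rightarrow> (complex, nat \<Rightarrow> 'a) module" where
  "graded_completion A Ag =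
     \<lparr>carrier = {u. \<forall>k. u k \<in> Ag k},
      mult = (\<lambda>u v k. \<Oplus>\<^bsub>A\<^esub>i\<in>{..k}. u i \<otimes>\<^bsub>A\<^esub> v (k - i)),
      one = (\<lambda>k. if k = 0 then \<one>\<^bsub>A\<^esub> else \<zero>\<^bsub>A\<^esub>),
      zero = (\<lambda>k. \<zero>\<^bsub>A\<^esub>),
      add = (\<lambda>u v k. u k \<oplus>\<^bsub>A\<^esub> v k),
      smult = (\<lambda>c u k. c \<odot>\<^bsub>A\<^esub> u k)\<rparr>"

definition degree_filtration ::
  "(complex, 'a) module \<Rightarrow> (nat \<Rightarrow> 'a set) \<Rightarrow> nat \<Rightarrow> (nat \<Rightarrow> 'a) set" where
  "degree_filtration A Ag k = {u \<in> carrier (graded_completion A Ag). \<forall>j<k. u j = \<zero>\<^bsub>A\<^esub>}"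

definition homogeneous :: "(complex, 'a) module \<Rightarrow> nat \<Rightarrow> 'a \<Rightarrow> nat \<Rightarrow> 'a" where
  "homogeneous A k a = (\<lambda>j. if j = k then a else \<zero>\<^bsub>A\<^esub>)"

section \<open>The Lie algebra \<open>\<pp>\<^sub>n(G)(\<complex>)\<close>\<close>

datatype 'n pgen = XX 'n 'n psu2 | XP 'n p1

definition pn_gens :: "psu2 set \<Rightarrow> 'n pgen set" where
  "pn_gens G = {XX i j g | i j g. i \<noteq> j \<and> g \<in> G} \<union> {XP i q | i q. q \<in> - P1_star G}"

abbreviation X2 :: "'n \<Rightarrow> 'n \<Rightarrow> psu2 \<Rightarrow> ('n pgen magma \<Rightarrow>\<^sub>0 complex)" where
  "X2 i j g \<equiv> basis (Leaf (XX i j g))"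

abbreviation X1 :: "'n \<Rightarrow> p1 \<Rightarrow> ('n pgen magma \<Rightarrow>\<^sub>0 complex)" where
  "X1 i q \<equiv> basis (Leaf (XP i q))"

abbreviation br :: "('x magma \<Rightarrow>\<^sub>0 complex) \<Rightarrow> ('x magma \<Rightarrow>\<^sub>0 complex) \<Rightarrow> ('x magma \<Rightarrow>\<^sub>0 complex)" where
  "br a b \<equiv> bilinear_ext Node a b"

definition pn_relators :: "psu2 set \<Rightarrow> ('n::finite pgen magma \<Rightarrow>\<^sub>0 complex) set" where
  "pn_relators G =
     {X2 i j g - X2 j i (inv\<^bsub>PSU2\<^esub> g) | i j g. i \<noteq> j \<and> g \<in> G} \<union>
     {(\<Sum>q\<in>- P1_star G. X1 i q) + (\<Sum>m\<in>- {i}. \<Sum>g\<in>G. X2 i m g) | i. True} \<union>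
     {br (X2 i j g) (X2 k l g') | i j k l g g'. distinct [i, j, k, l] \<and> g \<in> G \<and> g' \<in> G} \<union>
     {br (X2 i j g) (X2 k j (g' \<otimes>\<^bsub>PSU2\<^esub> g) + X2 k i g') | i j k g g'.
        distinct [i, j, k] \<and> g \<in> G \<and> g' \<in> G} \<union>
     {br (X1 i p) (X2 j k g') | i j k p g'.
        distinct [i, j, k] \<and> p \<in> - P1_star G \<and> g' \<in> G} \<union>
     {br (X1 i p) (X1 j q) | i j p q.
        i \<noteq> j \<and> p \<in> - P1_star G \<and> q \<in> - P1_star G - orb G p} \<union>
     {br (X2 i j g) (X1 j p + X1 i (psu2_act g p) + (\<Sum>h\<in>stab G p. X2 i j (g \<otimes>\<^bsub>PSU2\<^esub> h))) | i j g p.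
        i \<noteq> j \<and> g \<in> G \<and> p \<in> - P1_star G} \<union>
     {br (X1 j p) (X1 i (psu2_act g p) + (\<Sum>h\<in>stab G p. X2 i j (g \<otimes>\<^bsub>PSU2\<^esub> h))) | i j g p.
        i \<noteq> j \<and> g \<in> G \<and> p \<in> - P1_star G}"

type_synonym 'n pn = "('n pgen magma \<Rightarrow>\<^sub>0 complex) set"
type_synonym 'n Upn = "('n pn list \<Rightarrow>\<^sub>0 complex) set"

definition pn :: "psu2 set \<Rightarrow> (complex, 'n::finite pn) module" where
  "pn G = lie_presented (pn_gens G) (pn_relators G)"

definition pn_graded :: "psu2 set \<Rightarrow> nat \<Rightarrow> 'n::finite pn set" where
  "pn_graded G = lie_graded (pn_gens G) (pn_relators G)"

definition Upn :: "psu2 set \<Rightarrow> (complex, 'n::finite Upn) module" where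
  "Upn G = enveloping (pn G)"

definition Upn_graded :: "psu2 set \<Rightarrow> nat \<Rightarrow> 'n::finite Upn set" where
  "Upn_graded G = env_graded (pn G) (pn_graded G)"

text \<open>The image of a generator in the degree 1 part of the completed enveloping algebra.\<close>

definition Upn_gen :: "psu2 set \<Rightarrow> 'n::finite pgen \<Rightarrow> nat \<Rightarrow> 'n Upn" where
  "Upn_gen G x = homogeneous (Upn G) 1
     (env_class (pn G) (basis [lie_class (pn_gens G) (pn_relators G) (basis (Leaf x))]))"

section \<open>Holomorphic 1-forms on open subsets of \<open>(\<bbbP>\<^sup>1)\<^sup>n\<close>\<close>

text \<open>The standard charts are indexed by the set \<open>S\<close> of those factors on which the coordinate is
  \<open>1/z\<close> instead of \<open>z\<close>; \<open>chart_inv S\<close> is the inverse of the chart, defined on all of \<open>\<complex>\<^sup>n\<close>.\<close>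

definition chart_inv :: "'n set \<Rightarrow> complex^'n \<Rightarrow> 'n \<Rightarrow> p1" where
  "chart_inv S \<zeta> i = (if i \<in> S then (if \<zeta>$i = 0 then Inf else Fin (1 / \<zeta>$i)) else Fin (\<zeta>$i))"

definition complex_differentiable_at :: "(complex^'n \<Rightarrow> complex) \<Rightarrow> complex^'n::finite \<Rightarrow> bool" where
  "complex_differentiable_at f \<zeta> \<longleftrightarrow>
     (\<exists>c. (f has_derivative (\<lambda>v. \<Sum>i\<in>UNIV. c i * v$i)) (at \<zeta>))"

text \<open>A 1-form is given by its coefficients in all charts: \<open>\<eta> S \<zeta> $ i\<close> is the coefficient of
  \<open>d\<zeta>\<^sub>i\<close> at the point with coordinates \<open>\<zeta>\<close> in the chart \<open>S\<close>. Coefficients are set to 0 at points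
  outside \<open>X\<close>, so that equal forms on \<open>X\<close> are equal functions. If two charts have coordinates
  \<open>\<zeta>\<close> and \<open>\<xi>\<close> of the same point then \<open>\<xi>\<^sub>i = \<zeta>\<^sub>i\<close> or \<open>\<xi>\<^sub>i = 1/\<zeta>\<^sub>i\<close>.\<close>

type_synonym 'n form = "'n set \<Rightarrow> complex^'n \<Rightarrow> complex^'n"

definition transition_deriv :: "'n set \<Rightarrow> 'n set \<Rightarrow> complex^'n \<Rightarrow> 'n \<Rightarrow> complex" where
  "transition_deriv S T \<zeta> i = (if i \<in> S \<longleftrightarrow> i \<in> T then 1 else - 1 / (\<zeta>$i)\<^sup>2)"

definition holomorphic_form :: "('n \<Rightarrow> p1) set \<Rightarrow> 'n::finite form \<Rightarrow> bool" where
  "holomorphic_form X \<eta> \<longleftrightarrow>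
     (\<forall>S \<zeta>. chart_inv S \<zeta> \<notin> X \<longrightarrow> \<eta> S \<zeta> = 0) \<and>
     (\<forall>S T \<zeta> \<xi> i. chart_inv S \<zeta> \<in> X \<and> chart_inv S \<zeta> = chart_inv T \<xi> \<longrightarrow>
        \<eta> S \<zeta> $ i = \<eta> T \<xi> $ i * transition_deriv S T \<zeta> i) \<and>
     (\<forall>S \<zeta> i. chart_inv S \<zeta> \<in> X \<longrightarrow> complex_differentiable_at (\<lambda>\<xi>. \<eta> S \<xi> $ i) \<zeta>)"

definition Omega1 :: "('n \<Rightarrow> p1) set \<Rightarrow> (complex, 'n::finite form) module" where
  "Omega1 X = \<lparr>carrier = {\<eta>. holomorphic_form X \<eta>}, mult = undefined, one = undefined,
     zero = (\<lambda>S \<zeta>. 0), add = (\<lambda>\<eta> \<theta> S \<zeta>. \<eta> S \<zeta> + \<theta> S \<zeta>), smult = (\<lambda>c \<eta> S \<zeta>. c *s \<eta> S \<zeta>)\<rparr>"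

definition restrict_form :: "('n \<Rightarrow> p1) set \<Rightarrow> 'n form \<Rightarrow> 'n::finite form" where
  "restrict_form Y \<eta> = (\<lambda>S \<zeta>. if chart_inv S \<zeta> \<in> Y then \<eta> S \<zeta> else 0)"

text \<open>The form \<open>f(z) dz\<^sub>i\<close> on \<open>Y\<close>, for \<open>Y\<close> contained in the affine chart \<open>(\<bbbP>\<^sup>1 - {\<infinity>})\<^sup>n\<close>.\<close>

definition affine_form :: "('n \<Rightarrow> p1) set \<Rightarrow> 'n \<Rightarrow> (complex^'n \<Rightarrow> complex) \<Rightarrow> 'n::finite form" where
  "affine_form Y i f = (\<lambda>S \<zeta>. if chart_inv S \<zeta> \<in> Y
     then axis i (f (\<chi> j. if j \<in> S then 1 / \<zeta>$j else \<zeta>$j) * transition_deriv S {} \<zeta> i) else 0)"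

text \<open>The coefficient of \<open>dz\<close> in \<open>d log(z - p)\<close>, with \<open>d log(z - \<infinity>) = 0\<close>.\<close>

definition dlog_coeff :: "complex \<Rightarrow> p1 \<Rightarrow> complex" where
  "dlog_coeff z p = (case p of Fin a \<Rightarrow> 1 / (z - a) | Inf \<Rightarrow> 0)"

definition dlog1 :: "('n \<Rightarrow> p1) set \<Rightarrow> 'n \<Rightarrow> p1 \<Rightarrow> 'n::finite form" where
  "dlog1 Y i p = affine_form Y i (\<lambda>z. dlog_coeff (z$i) p)"

text \<open>The \<open>dz\<^sub>i\<close>-part of \<open>d log(z\<^sub>i - g\<cdot>z\<^sub>j)\<close>; it vanishes where \<open>g\<cdot>z\<^sub>j = \<infinity>\<close>.\<close>

definition dlog2 :: "('n \<Rightarrow> p1) set \<Rightarrow> 'n \<Rightarrow> 'n \<Rightarrow> psu2 \<Rightarrow> 'n::finite form" where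
  "dlog2 Y i j g = affine_form Y i (\<lambda>z. dlog_coeff (z$i) (psu2_act g (Fin (z$j))))"

section \<open>Tensor products, completions, and forms with values in a complete graded algebra\<close>

definition bilinear_relators :: "(complex, 'v) module \<Rightarrow> (complex, 'w) module \<Rightarrow> ('v \<times> 'w \<Rightarrow>\<^sub>0 complex) set" where
  "bilinear_relators V W =
     {basis (v \<oplus>\<^bsub>V\<^esub> v', w) - basis (v, w) - basis (v', w) | v v' w.
        v \<in> carrier V \<and> v' \<in> carrier V \<and> w \<in> carrier W} \<union>
     {basis (v, w \<oplus>\<^bsub>W\<^esub> w') - basis (v, w) - basis (v, w') | v w w'.
        v \<in> carrier V \<and> w \<in> carrier W \<and> w' \<in> carrier W} \<union>
     {basis (c \<odot>\<^bsub>V\<^esub> v, w) - scale c (basis (v, w)) | c v w. v \<in> carrier V \<and> w \<in> carrier W} \<union>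
     {basis (v, c \<odot>\<^bsub>W\<^esub> w) - scale c (basis (v, w)) | c v w. v \<in> carrier V \<and> w \<in> carrier W}"

definition tensor_kernel :: "(complex, 'v) module \<Rightarrow> (complex, 'w) module \<Rightarrow> ('v \<times> 'w \<Rightarrow>\<^sub>0 complex) set" where
  "tensor_kernel V W =
     (\<lambda>N. submodule N CC (free_module (carrier V \<times> carrier W))) hull bilinear_relators V W"

definition tensor ::
  "(complex, 'v) module \<Rightarrow> (complex, 'w) module \<Rightarrow> (complex, ('v \<times> 'w \<Rightarrow>\<^sub>0 complex) set) module" where
  "tensor V W = quot_module (free_module (carrier V \<times> carrier W)) (tensor_kernel V W)"

definition tensor_class ::
  "(complex, 'v) module \<Rightarrow> (complex, 'w) module \<Rightarrow> ('v \<times> 'w \<Rightarrow>\<^sub>0 complex) \<Rightarrow> ('v \<times> 'w \<Rightarrow>\<^sub>0 complex) set" where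
  "tensor_class V W f = tensor_kernel V W +>\<^bsub>free_module (carrier V \<times> carrier W)\<^esub> f"

text \<open>The image of \<open>V \<otimes> W'\<close> in \<open>V \<otimes> W\<close>, for a subspace \<open>W'\<close> of \<open>W\<close>.\<close>

definition tensor_image ::
  "(complex, 'v) module \<Rightarrow> (complex, 'w) module \<Rightarrow> 'w set \<Rightarrow> ('v \<times> 'w \<Rightarrow>\<^sub>0 complex) set set" where
  "tensor_image V W W' = tensor_class V W ` {f. Poly_Mapping.keys f \<subseteq> carrier V \<times> W'}"

text \<open>The map \<open>\<phi> \<otimes> id : V \<otimes> W \<rightarrow> V' \<otimes> W\<close> induced by a linear map \<open>\<phi> : V \<rightarrow> V'\<close>. Here and in
  \<open>completion_map\<close>, all members of the union are the same coset.\<close>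

definition tensor_map ::
  "(complex, 'v') module \<Rightarrow> (complex, 'w) module \<Rightarrow> ('v \<Rightarrow> 'v') \<Rightarrow>
     ('v \<times> 'w \<Rightarrow>\<^sub>0 complex) set \<Rightarrow> ('v' \<times> 'w \<Rightarrow>\<^sub>0 complex) set" where
  "tensor_map V' W \<phi> x = (\<Union>f\<in>x. tensor_class V' W
     (\<Sum>(v, w)\<in>Poly_Mapping.keys f. Poly_Mapping.single (\<phi> v, w) (Poly_Mapping.lookup f (v, w))))"

text \<open>The completion of \<open>M\<close> for a decreasing filtration \<open>F\<close> is the inverse limit of the \<open>M / F k\<close>;
  the condition \<open>c (Suc k) \<subseteq> c k\<close> says that the coset \<open>c (Suc k)\<close> is mapped to \<open>c k\<close>.\<close>

definition completion :: "(complex, 'a) module \<Rightarrow> (nat \<Rightarrow> 'a set) \<Rightarrow> (complex, nat \<Rightarrow> 'a set) module" where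
  "completion M F =
     \<lparr>carrier = {c. \<forall>k. c k \<in> carrier (quot_module M (F k)) \<and> c (Suc k) \<subseteq> c k},
      mult = undefined, one = undefined,
      zero = (\<lambda>k. \<zero>\<^bsub>quot_module M (F k)\<^esub>),
      add = (\<lambda>c d k. c k \<oplus>\<^bsub>quot_module M (F k)\<^esub> d k),
      smult = (\<lambda>a c k. a \<odot>\<^bsub>quot_module M (F k)\<^esub> c k)\<rparr>"

definition completion_map ::
  "(complex, 'b) module \<Rightarrow> (nat \<Rightarrow> 'b set) \<Rightarrow> ('a \<Rightarrow> 'b) \<Rightarrow> (nat \<Rightarrow> 'a set) \<Rightarrow> nat \<Rightarrow> 'b set" where
  "completion_map M F h c = (\<lambda>k. \<Union>x\<in>c k. F k +>\<^bsub>M\<^esub> h x)"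

text \<open>In the following, \<open>A\<close> is an algebra with grading \<open>Ag\<close>, and the forms take values in the
  completion of \<open>A\<close> for the degree.\<close>

definition forms_filtration ::
  "('n \<Rightarrow> p1) set \<Rightarrow> (complex, 'a) module \<Rightarrow> (nat \<Rightarrow> 'a set) \<Rightarrow> nat \<Rightarrow>
     ('n::finite form \<times> (nat \<Rightarrow> 'a) \<Rightarrow>\<^sub>0 complex) set set" where
  "forms_filtration X A Ag k =
     tensor_image (Omega1 X) (graded_completion A Ag) (degree_filtration A Ag k)"

definition forms_with_values ::
  "('n \<Rightarrow> p1) set \<Rightarrow> (complex, 'a) module \<Rightarrow> (nat \<Rightarrow> 'a set) \<Rightarrow>
     (complex, nat \<Rightarrow> ('n::finite form \<times> (nat \<Rightarrow> 'a) \<Rightarrow>\<^sub>0 complex) set set) module" where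
  "forms_with_values X A Ag =
     completion (tensor (Omega1 X) (graded_completion A Ag)) (forms_filtration X A Ag)"

definition ctensor ::
  "('n \<Rightarrow> p1) set \<Rightarrow> (complex, 'a) module \<Rightarrow> (nat \<Rightarrow> 'a set) \<Rightarrow> 'n::finite form \<Rightarrow> (nat \<Rightarrow> 'a) \<Rightarrow>
     nat \<Rightarrow> ('n form \<times> (nat \<Rightarrow> 'a) \<Rightarrow>\<^sub>0 complex) set set" where
  "ctensor X A Ag \<eta> a = (\<lambda>k. forms_filtration X A Ag k
     +>\<^bsub>tensor (Omega1 X) (graded_completion A Ag)\<^esub>
       tensor_class (Omega1 X) (graded_completion A Ag) (basis (\<eta>, a)))"

definition restrict_values ::
  "('n \<Rightarrow> p1) set \<Rightarrow> (complex, 'a) module \<Rightarrow> (nat \<Rightarrow> 'a set) \<Rightarrow>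
     (nat \<Rightarrow> ('n::finite form \<times> (nat \<Rightarrow> 'a) \<Rightarrow>\<^sub>0 complex) set set) \<Rightarrow>
     nat \<Rightarrow> ('n form \<times> (nat \<Rightarrow> 'a) \<Rightarrow>\<^sub>0 complex) set set" where
  "restrict_values Y A Ag =
     completion_map (tensor (Omega1 Y) (graded_completion A Ag)) (forms_filtration Y A Ag)
       (tensor_map (Omega1 Y) (graded_completion A Ag) (restrict_form Y))"

abbreviation pn_forms ::
  "psu2 set \<Rightarrow> ('n \<Rightarrow> p1) set \<Rightarrow>
     (complex, nat \<Rightarrow> ('n::finite form \<times> (nat \<Rightarrow> 'n Upn) \<Rightarrow>\<^sub>0 complex) set set) module" where
  "pn_forms G X \<equiv> forms_with_values X (Upn G) (Upn_graded G)"

abbreviation pn_ctensor ::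
  "psu2 set \<Rightarrow> ('n \<Rightarrow> p1) set \<Rightarrow> 'n::finite form \<Rightarrow> (nat \<Rightarrow> 'n Upn) \<Rightarrow>
     nat \<Rightarrow> ('n form \<times> (nat \<Rightarrow> 'n Upn) \<Rightarrow>\<^sub>0 complex) set set" where
  "pn_ctensor G X \<equiv> ctensor X (Upn G) (Upn_graded G)"

abbreviation pn_restrict ::
  "psu2 set \<Rightarrow> ('n \<Rightarrow> p1) set \<Rightarrow>
     (nat \<Rightarrow> ('n::finite form \<times> (nat \<Rightarrow> 'n Upn) \<Rightarrow>\<^sub>0 complex) set set) \<Rightarrow>
     nat \<Rightarrow> ('n form \<times> (nat \<Rightarrow> 'n Upn) \<Rightarrow>\<^sub>0 complex) set set" where
  "pn_restrict G Y \<equiv> restrict_values Y (Upn G) (Upn_graded G)"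

end

theory Submission
  imports Defs "HOL-Library.Function_Algebras" "HOL-Computational_Algebra.Polynomial"
begin

text \<open>For fixed \<open>i\<close>, relation (2) says that the generators \<open>X\<^sub>t\<close> in the \<open>dz\<^sub>i\<close>-part of \<open>\<omega>\<close> add up to
  0, so a fixed \<open>dlog\<close> can be subtracted from all their coefficients. What is left are the forms
  \<open>dz\<^sub>i / (z\<^sub>i - a) - dz\<^sub>i / (z\<^sub>i - b)\<close>, which extend to \<open>z\<^sub>i = \<infinity>\<close> and to \<open>a = \<infinity>\<close> or \<open>b = \<infinity>\<close>. For
  uniqueness, restriction of holomorphic forms to the dense subset \<open>U\<close> is injective, hence has a
  linear left inverse, and therefore stays injective after tensoring with the quotients of the
  completed enveloping algebra.\<close>

section \<open>Homogeneous coordinates and the action of \<open>PSU\<^sub>2(\<complex>)\<close>\<close>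

text \<open>The \<open>dlog\<close> subtracted for index i must have a pole that z_i avoids on the
  whole configuration space. No fixed point works in general: for trivial G every point of P^1 is a
  possible value of z_i. So one of the poles of the form itself is taken, and it may move with some
  z_j. This is why poles are functions of the configuration, and why homogeneous coordinates, in
  which a moving pole crosses infinity smoothly, replace case distinctions. The values live in
  iterated quotients, and an element of the completion may need a different representative at each
  level. Equalities are therefore pulled back, level by level, to finitely supported functions and
  to membership in \<open>tensor_kernel\<close>. The candidate and the prescribed form each have one
  representative serving all levels, so existence is a single membership; uniqueness treats each
  level separately. The left inverse of restriction comes from a choice of basis, with no
  continuity; it respects the filtration because that lives on the second tensor factor.\<close>

definition homog :: "p1 \<Rightarrow> complex \<times> complex" where
  "homog p = (case p of Fin z \<Rightarrow> (z, 1) | Inf \<Rightarrow> (1, 0))"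

lemma homog_simps [simp]: "homog (Fin z) = (z, 1)" "homog Inf = (1, 0)"
  by (simp_all add: homog_def)

text \<open>The determinant of two vectors. For nonzero vectors it vanishes exactly when they span
  the same line, so it compares points of P^1 without singling out infinity.\<close>

definition wedge :: "complex \<times> complex \<Rightarrow> complex \<times> complex \<Rightarrow> complex" where
  "wedge v w = fst v * snd w - snd v * fst w"

definition rescale :: "complex \<Rightarrow> complex \<times> complex \<Rightarrow> complex \<times> complex" where
  "rescale c v = (c * fst v, c * snd v)"

definition mat_apply :: "complex^2^2 \<Rightarrow> complex \<times> complex \<Rightarrow> complex \<times> complex" where
  "mat_apply A v = (A$1$1 * fst v + A$1$2 * snd v, A$2$1 * fst v + A$2$2 * snd v)"

lemma wedge_rescale [simp]: "wedge (rescale c v) w = c * wedge v w" "wedge v (rescale c w) = c * wedge v w"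
  by (simp_all add: wedge_def rescale_def algebra_simps)

lemma rescale_rescale: "rescale c (rescale d v) = rescale (c * d) v"
  by (simp add: rescale_def)

lemma mat_apply_rescale: "mat_apply A (rescale c v) = rescale c (mat_apply A v)"
  by (simp add: mat_apply_def rescale_def algebra_simps)

lemma mat_apply_mult: "mat_apply (A ** B) v = mat_apply A (mat_apply B v)"
  by (simp add: mat_apply_def matrix_matrix_mult_def sum_2 algebra_simps)

lemma wedge_homog_eq_0_iff: "wedge (homog p) (homog q) = 0 \<longleftrightarrow> p = q"
  by (cases p; cases q) (auto simp: wedge_def)

text \<open>The factor is the denominator of the homography if the image is finite and its numerator
  if the image is \<open>Inf\<close>; invertibility of A keeps the two from vanishing
  together.\<close>

lemma mat_apply_homog:
  assumes "det A = 1"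
  obtains c where "c \<noteq> 0" "mat_apply A (homog p) = rescale c (homog (homography A p))"
proof (cases "homography A p")
  case (Fin w)
  show thesis
    by (rule that[of "snd (mat_apply A (homog p))"]; use Fin in \<open>cases p\<close>)
      (auto simp: mat_apply_def homography_def rescale_def split: if_splits)
next
  case Inf
  have "snd (mat_apply A (homog p)) = 0"
    using Inf by (cases p) (auto simp: mat_apply_def homography_def split: if_splits)
  moreover have "fst (mat_apply A (homog p)) \<noteq> 0"
  proof
    assume fst0: "fst (mat_apply A (homog p)) = 0"
    \<comment> \<open>Cramer's rule: the adjugate recovers the vector from its image.\<close>
    have "det A * fst (homog p) = A$2$2 * fst (mat_apply A (homog p)) - A$1$2 * snd (mat_apply A (homog p))"
      "det A * snd (homog p) = A$1$1 * snd (mat_apply A (homog p)) - A$2$1 * fst (mat_apply A (homog p))"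
      by (simp_all add: mat_apply_def det_2 algebra_simps)
    with fst0 \<open>snd _ = 0\<close> assms show False by (cases p) auto
  qed
  ultimately show thesis
    by (intro that[of "fst (mat_apply A (homog p))"]) (auto simp: Inf rescale_def prod_eq_iff)
qed

text \<open>On homogeneous coordinates composition is associativity of the matrix product; the
  unknown factors c, d, e disappear when the two points are compared by
  \<open>wedge\<close>.\<close>

lemma homography_mult:
  assumes "det A = 1" "det B = 1"
  shows "homography (A ** B) p = homography A (homography B p)"
proof -
  obtain c where c: "c \<noteq> 0" "mat_apply (A ** B) (homog p) = rescale c (homog (homography (A ** B) p))"
    using mat_apply_homog[of "A ** B"] assms by (auto simp: det_mul)
  obtain d where d: "d \<noteq> 0" "mat_apply B (homog p) = rescale d (homog (homography B p))"
    using mat_apply_homog[OF assms(2)] by blast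
  obtain e where e: "e \<noteq> 0" "mat_apply A (homog (homography B p)) = rescale e (homog (homography A (homography B p)))"
    using mat_apply_homog[OF assms(1)] by blast
  have eq: "rescale c (homog (homography (A ** B) p)) = rescale (d * e) (homog (homography A (homography B p)))"
    using c d e by (simp add: mat_apply_mult mat_apply_rescale rescale_rescale)
  have "wedge (rescale c (homog (homography (A ** B) p))) (homog (homography A (homography B p))) = 0"
    unfolding eq by (simp add: wedge_homog_eq_0_iff)
  then show ?thesis using c(1) by (simp add: wedge_homog_eq_0_iff)
qed

lemma homography_one [simp]: "homography (mat 1) p = p"
  by (cases p) (auto simp: homography_def mat_def)

text \<open>Finite fixed points are roots of a polynomial of degree at most 2. It vanishes
  identically only for a scalar matrix, and determinant 1 leaves just the two excluded ones.\<close>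

lemma finite_fixed_points:
  assumes "det A = 1" "A \<noteq> mat 1" "A \<noteq> - mat 1"
  shows "finite {p. homography A p = p}"
proof -
  let ?q = "[:- A$1$2, A$2$2 - A$1$1, A$2$1:]"
  have "?q \<noteq> 0"
  proof
    assume "?q = 0"
    then have *: "A$1$2 = 0" "A$2$1 = 0" "A$2$2 = A$1$1" by auto
    with assms(1) have "A$1$1 * A$1$1 = 1" by (simp add: det_2)
    then have "A$1$1 = 1 \<or> A$1$1 = - 1" by (simp add: square_eq_1_iff)
    then have "A = mat 1 \<or> A = - mat 1"
      using * by (auto simp: vec_eq_iff forall_2 mat_def)
    with assms show False by blast
  qed
  then have "finite {z. poly ?q z = 0}" by (rule poly_roots_finite)
  moreover have "{p. homography A p = p} \<subseteq> insert Inf (Fin ` {z. poly ?q z = 0})"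
  proof
    fix p assume p: "p \<in> {p. homography A p = p}"
    show "p \<in> insert Inf (Fin ` {z. poly ?q z = 0})"
    proof (cases p)
      case (Fin z)
      then have "A$2$1 * z + A$2$2 \<noteq> 0" "(A$1$1 * z + A$1$2) / (A$2$1 * z + A$2$2) = z"
        using p by (auto simp: homography_def split: if_splits)
      then have "A$1$1 * z + A$1$2 = z * (A$2$1 * z + A$2$2)" by (simp add: field_simps)
      then show ?thesis using Fin by (auto simp: algebra_simps)
    qed simp
  qed
  ultimately show ?thesis by (meson finite_imageI finite_insert finite_subset)
qed

section \<open>The group PSU_2, its action, and the points with nontrivial stabilizer\<close>

lemma conj_transpose_mult: "conj_transpose (A ** B) = conj_transpose B ** conj_transpose A"
  by (simp add: conj_transpose_def matrix_matrix_mult_def vec_eq_iff mult.commute)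

lemma det_conj_transpose: "det (conj_transpose A) = cnj (det A)"
  by (simp add: conj_transpose_def det_2)

lemma conj_transpose_conj_transpose [simp]: "conj_transpose (conj_transpose A) = A"
  by (simp add: conj_transpose_def vec_eq_iff)

lemma group_SU2: "Group.group SU2"
proof (rule groupI)
  fix A B assume "A \<in> carrier SU2" "B \<in> carrier SU2"
  then have A: "A ** conj_transpose A = mat 1" "det A = 1"
    and B: "B ** conj_transpose B = mat 1" "det B = 1" by (auto simp: SU2_def)
  have "(A ** B) ** conj_transpose (A ** B) = A ** (B ** conj_transpose B) ** conj_transpose A"
    by (simp add: conj_transpose_mult matrix_mul_assoc)
  also have "\<dots> = mat 1" by (simp add: A B)
  finally show "A \<otimes>\<^bsub>SU2\<^esub> B \<in> carrier SU2" using A B by (simp add: SU2_def det_mul)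
next
  have "conj_transpose (mat 1) = mat 1"
    by (simp add: conj_transpose_def mat_def vec_eq_iff)
  then show "\<one>\<^bsub>SU2\<^esub> \<in> carrier SU2" by (simp add: SU2_def)
next
  fix A assume "A \<in> carrier SU2"
  then have A: "A ** conj_transpose A = mat 1" "det A = 1" by (auto simp: SU2_def)
  then have "conj_transpose A ** A = mat 1" by (simp add: matrix_left_right_inverse)
  then show "\<exists>B\<in>carrier SU2. B \<otimes>\<^bsub>SU2\<^esub> A = \<one>\<^bsub>SU2\<^esub>"
    using A by (intro bexI[of _ "conj_transpose A"]) (auto simp: SU2_def det_conj_transpose)
qed (auto simp: SU2_def matrix_mul_assoc)

lemma uminus_matrix_mult:
  fixes A B :: "complex^2^2"
  shows "(- A) ** B = - (A ** B)" "A ** (- B) = - (A ** B)"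
  by (simp_all add: matrix_matrix_mult_def vec_eq_iff sum_negf)

lemma group_PSU2: "Group.group PSU2"
proof -
  interpret S: Group.group SU2 by (rule group_SU2)
  have neg1: "- mat 1 \<in> carrier SU2"
    by (simp add: SU2_def conj_transpose_def mat_def vec_eq_iff matrix_matrix_mult_def det_2 sum_2 forall_2)
  have "subgroup {mat 1, - mat 1} SU2"
  proof (rule S.subgroupI)
    show "{mat 1, - mat 1} \<subseteq> carrier SU2"
      using neg1 S.one_closed by (simp add: SU2_def)
    have "inv\<^bsub>SU2\<^esub> (mat 1) = mat 1" using S.inv_one by (simp add: SU2_def)
    moreover have "inv\<^bsub>SU2\<^esub> (- mat 1) = - mat 1"
      by (rule S.inv_equality) (use neg1 in \<open>auto simp: SU2_def uminus_matrix_mult\<close>)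
    ultimately show "inv\<^bsub>SU2\<^esub> A \<in> {mat 1, - mat 1}" if "A \<in> {mat 1, - mat 1}" for A
      using that by auto
  qed (auto simp: SU2_def uminus_matrix_mult)
  then have "{mat 1, - mat 1} \<lhd> SU2"
    by (intro S.normalI)
      (auto simp: r_coset_def l_coset_def, auto simp: SU2_def uminus_matrix_mult)
  then show ?thesis
    unfolding PSU2_def by (rule normal.factorgroup_is_group)
qed

lemma one_PSU2: "\<one>\<^bsub>PSU2\<^esub> = {mat 1, - mat 1}"
  by (simp add: PSU2_def)

lemma psu2_act_one: "psu2_act \<one>\<^bsub>PSU2\<^esub> p = p"
  using psu2_act_eq[of "\<one>\<^bsub>PSU2\<^esub>" "mat 1" p] group_PSU2
  by (simp add: one_PSU2 Group.group.is_monoid monoid.one_closed flip: one_PSU2)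
    (simp add: one_PSU2)

lemma psu2_act_mult:
  assumes "g \<in> carrier PSU2" "h \<in> carrier PSU2"
  shows "psu2_act (g \<otimes>\<^bsub>PSU2\<^esub> h) p = psu2_act g (psu2_act h p)"
proof -
  interpret Group.group PSU2 by (rule group_PSU2)
  obtain A where A: "A \<in> carrier SU2" "g = {A, - A}" using PSU2_carrier_cases[OF assms(1)] by blast
  obtain B where B: "B \<in> carrier SU2" "h = {B, - B}" using PSU2_carrier_cases[OF assms(2)] by blast
  have "A ** B \<in> g \<otimes>\<^bsub>PSU2\<^esub> h"
    by (auto simp: A B PSU2_def set_mult_def) (auto simp: SU2_def)
  then have "psu2_act (g \<otimes>\<^bsub>PSU2\<^esub> h) p = homography (A ** B) p"
    using psu2_act_eq[OF m_closed[OF assms]] by blast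
  also have "\<dots> = homography A (homography B p)"
    by (rule homography_mult) (use A B in \<open>auto simp: SU2_def\<close>)
  finally show ?thesis
    using psu2_act_eq[OF assms(1), of A] psu2_act_eq[OF assms(2), of B] A B by simp
qed

lemma finite_fixed_psu2:
  assumes "g \<in> carrier PSU2" "g \<noteq> \<one>\<^bsub>PSU2\<^esub>"
  shows "finite {p. psu2_act g p = p}"
proof -
  obtain A where A: "A \<in> carrier SU2" "g = {A, - A}" using PSU2_carrier_cases[OF assms(1)] by blast
  then have "A \<noteq> mat 1" "A \<noteq> - mat 1" "det A = 1"
    using assms(2) by (auto simp: one_PSU2 SU2_def)
  then show ?thesis
    using finite_fixed_points[of A] psu2_act_eq[OF assms(1), of A] A by simp
qed

lemma mem_P1_star_iff:
  assumes "subgroup G PSU2"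
  shows "p \<in> P1_star G \<longleftrightarrow> (\<forall>g\<in>G. psu2_act g p = p \<longrightarrow> g = \<one>\<^bsub>PSU2\<^esub>)"
  using subgroup.one_closed[OF assms]
  by (auto simp: P1_star_def stab_def stabilizer_def psu2_act_one)

text \<open>Without this the sums over \<open>- P1_star G\<close>, in relation (2) and in the
  prescribed form, would be 0 by the convention for infinite index sets.\<close>

lemma finite_not_P1_star:
  assumes "subgroup G PSU2" "finite G"
  shows "finite (- P1_star G)"
proof -
  have "- P1_star G \<subseteq> (\<Union>g\<in>G - {\<one>\<^bsub>PSU2\<^esub>}. {p. psu2_act g p = p})"
    by (auto simp: mem_P1_star_iff[OF assms(1)])
  moreover have "finite (\<Union>g\<in>G - {\<one>\<^bsub>PSU2\<^esub>}. {p. psu2_act g p = p})"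
    using assms finite_fixed_psu2 subgroup.subset[OF assms(1)] by blast
  ultimately show ?thesis by (rule finite_subset)
qed

text \<open>The stabilizers of p and of its translate are conjugate. Read contrapositively, G
  preserves the set of points that index the generators \<open>XP\<close>.\<close>

lemma psu2_act_P1_star:
  assumes G: "subgroup G PSU2" and g: "g \<in> G" and p: "psu2_act g p \<in> P1_star G"
  shows "p \<in> P1_star G"
proof -
  interpret Group.group PSU2 by (rule group_PSU2)
  interpret subgroup G PSU2 by (rule G)
  have "h = \<one>\<^bsub>PSU2\<^esub>" if h: "h \<in> G" "psu2_act h p = p" for h
  proof -
    have "psu2_act (inv\<^bsub>PSU2\<^esub> g) (psu2_act g p) = p"
      using g psu2_act_mult[of "inv\<^bsub>PSU2\<^esub> g" g p] by (simp add: psu2_act_one)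
    then have "psu2_act (g \<otimes>\<^bsub>PSU2\<^esub> h \<otimes>\<^bsub>PSU2\<^esub> inv\<^bsub>PSU2\<^esub> g) (psu2_act g p) = psu2_act g p"
      using g h by (simp add: psu2_act_mult)
    then have eq: "g \<otimes>\<^bsub>PSU2\<^esub> h \<otimes>\<^bsub>PSU2\<^esub> inv\<^bsub>PSU2\<^esub> g = \<one>\<^bsub>PSU2\<^esub>"
      using p g h by (auto simp: mem_P1_star_iff[OF G])
    have "h = inv\<^bsub>PSU2\<^esub> g \<otimes>\<^bsub>PSU2\<^esub> (g \<otimes>\<^bsub>PSU2\<^esub> h \<otimes>\<^bsub>PSU2\<^esub> inv\<^bsub>PSU2\<^esub> g) \<otimes>\<^bsub>PSU2\<^esub> g"
      using g h by (simp add: m_assoc inv_solve_left' flip: m_assoc) (simp add: m_assoc)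
    then show ?thesis using g by (simp add: eq)
  qed
  then show ?thesis by (simp add: mem_P1_star_iff[OF G])
qed

section \<open>Quotients of spaces with a basis\<close>

lemma lookup_scale [simp]: "Poly_Mapping.lookup (scale c f) k = c * Poly_Mapping.lookup f k"
  by (simp add: scale_def Poly_Mapping.map.rep_eq when_def)

lemma keys_scale: "Poly_Mapping.keys (scale c f) \<subseteq> Poly_Mapping.keys f"
  by (auto simp: in_keys_iff)

lemma scale_zero [simp]: "scale c 0 = 0"
  and scale_0 [simp]: "scale 0 f = 0"
  and scale_1 [simp]: "scale 1 f = f"
  and scale_add: "scale c (f + g) = scale c f + scale c g"
  and scale_minus1: "scale (- 1) f = - f"
  and scale_single: "scale c (Poly_Mapping.single k a) = Poly_Mapping.single k (c * a)"
  by (rule poly_mapping_eqI, simp add: lookup_add lookup_minus lookup_single algebra_simps when_def)+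

text \<open>Shaped like the sum inside \<open>tensor_map\<close>, of which it is the version on
  representatives.\<close>

definition pm_map :: "('a \<Rightarrow> 'b) \<Rightarrow> ('a \<Rightarrow>\<^sub>0 complex) \<Rightarrow> ('b \<Rightarrow>\<^sub>0 complex)" where
  "pm_map m f = (\<Sum>k\<in>Poly_Mapping.keys f. Poly_Mapping.single (m k) (Poly_Mapping.lookup f k))"

lemma pm_map_superset:
  assumes "finite K" "Poly_Mapping.keys f \<subseteq> K"
  shows "pm_map m f = (\<Sum>k\<in>K. Poly_Mapping.single (m k) (Poly_Mapping.lookup f k))"
  unfolding pm_map_def
  by (rule sum.mono_neutral_left) (use assms in \<open>auto simp: in_keys_iff\<close>)

lemma pm_map_zero [simp]: "pm_map m 0 = 0"
  by (simp add: pm_map_def)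

lemma pm_map_single [simp]: "pm_map m (Poly_Mapping.single k a) = Poly_Mapping.single (m k) a"
  by (simp add: pm_map_def)

lemma pm_map_add: "pm_map m (f + g) = pm_map m f + pm_map m g"
  unfolding pm_map_def
  by (rule setsum_keys_plus_distrib) (simp_all add: single_add)

lemma pm_map_scale: "pm_map m (scale c f) = scale c (pm_map m f)"
proof -
  have "scale c (sum h K) = (\<Sum>k\<in>K. scale c (h k))" for h :: "'b \<Rightarrow> 'a \<Rightarrow>\<^sub>0 complex" and K
    by (induction K rule: infinite_finite_induct) (simp_all add: scale_add)
  from this[of "\<lambda>k. Poly_Mapping.single (m k) (Poly_Mapping.lookup f k)"] show ?thesis
    by (simp add: pm_map_superset[OF finite_keys keys_scale] pm_map_def[of m f] scale_single)
qed

lemma pm_map_minus: "pm_map m (f - g) = pm_map m f - pm_map m g"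
  using pm_map_add[of m "f - g" g] by simp

lemma pm_map_sum: "pm_map m (sum h K) = (\<Sum>k\<in>K. pm_map m (h k))"
  by (induction K rule: infinite_finite_induct) (simp_all add: pm_map_add)

lemma pm_map_comp: "pm_map m (pm_map m' f) = pm_map (m \<circ> m') f"
  by (simp add: pm_map_def[of m' f] pm_map_sum) (simp add: pm_map_def)

lemma pm_map_ident:
  assumes "\<And>k. k \<in> Poly_Mapping.keys f \<Longrightarrow> m k = k"
  shows "pm_map m f = f"
proof (rule poly_mapping_eqI)
  fix k
  have "Poly_Mapping.lookup (pm_map m f) k =
    (\<Sum>k'\<in>Poly_Mapping.keys f. if k' = k then Poly_Mapping.lookup f k' else 0)"
    using assms by (auto simp: pm_map_def lookup_sum lookup_single when_def intro!: sum.cong)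
  then show "Poly_Mapping.lookup (pm_map m f) k = Poly_Mapping.lookup f k"
    by (simp add: sum.delta' in_keys_iff)
qed

lemma keys_pm_map: "Poly_Mapping.keys (pm_map m f) \<subseteq> m ` Poly_Mapping.keys f"
  unfolding pm_map_def by (rule order_trans[OF Poly_Mapping.keys_sum]) auto

section \<open>Subspaces, cosets and quotients, detached from the module records\<close>

definition coset :: "'a::ab_group_add set \<Rightarrow> 'a \<Rightarrow> 'a set" where
  "coset N x = (\<lambda>n. n + x) ` N"

definition subspace_of :: "'k set \<Rightarrow> ('k \<Rightarrow>\<^sub>0 complex) set \<Rightarrow> bool" where
  "subspace_of K N \<longleftrightarrow> (\<forall>f\<in>N. Poly_Mapping.keys f \<subseteq> K) \<and> 0 \<in> N \<and>
     (\<forall>f\<in>N. \<forall>g\<in>N. f + g \<in> N) \<and> (\<forall>c. \<forall>f\<in>N. scale c f \<in> N)"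

lemma subspace_ofD:
  assumes "subspace_of K N"
  shows "f \<in> N \<Longrightarrow> Poly_Mapping.keys f \<subseteq> K" "0 \<in> N"
    "f \<in> N \<Longrightarrow> g \<in> N \<Longrightarrow> f + g \<in> N" "f \<in> N \<Longrightarrow> scale c f \<in> N"
    "f \<in> N \<Longrightarrow> - f \<in> N" "f \<in> N \<Longrightarrow> g \<in> N \<Longrightarrow> f - g \<in> N"
proof -
  show *: "f \<in> N \<Longrightarrow> Poly_Mapping.keys f \<subseteq> K" "0 \<in> N"
    "f \<in> N \<Longrightarrow> g \<in> N \<Longrightarrow> f + g \<in> N" "f \<in> N \<Longrightarrow> scale c f \<in> N" for f g c
    using assms by (auto simp: subspace_of_def)
  show neg: "f \<in> N \<Longrightarrow> - f \<in> N" for f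
    using *(4)[of f "-1"] by (simp add: scale_minus1)
  show "f \<in> N \<Longrightarrow> g \<in> N \<Longrightarrow> f - g \<in> N"
    using *(3)[of f "-g"] neg[of g] by simp
qed

lemma subspace_of_sum:
  assumes "subspace_of K N" "\<And>a. a \<in> A \<Longrightarrow> h a \<in> N"
  shows "sum h A \<in> N"
  using assms(2)
  by (induction A rule: infinite_finite_induct) (auto intro: subspace_ofD[OF assms(1)])

lemma coset_eq_iff:
  assumes "subspace_of K N"
  shows "coset N x = coset N y \<longleftrightarrow> x - y \<in> N"
proof
  assume "coset N x = coset N y"
  moreover have "x \<in> coset N x"
    using subspace_ofD(2)[OF assms] by (force simp: coset_def)
  ultimately show "x - y \<in> N" by (auto simp: coset_def)
next
  assume *: "x - y \<in> N"
  have "n + x \<in> coset N y" if "n \<in> N" for n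
    using subspace_ofD(3)[OF assms that *] by (force simp: coset_def)
  moreover have "n + y \<in> coset N x" if "n \<in> N" for n
    using subspace_ofD(6)[OF assms that *] by (force simp: coset_def algebra_simps)
  ultimately show "coset N x = coset N y" by (auto simp: coset_def)
qed

text \<open>Common to the free nonassociative algebra, the free algebra and the free module.\<close>

definition spanned_by :: "(complex, 'k \<Rightarrow>\<^sub>0 complex) module \<Rightarrow> 'k set \<Rightarrow> bool" where
  "spanned_by M K \<longleftrightarrow> carrier M = {f. Poly_Mapping.keys f \<subseteq> K} \<and> add M = (+) \<and> zero M = 0 \<and>
     smult M = scale"

lemma subspace_of_UNIV: "subspace_of K {f. Poly_Mapping.keys f \<subseteq> K}"
  unfolding subspace_of_def
  by (auto dest: subsetD[OF Poly_Mapping.keys_add] subsetD[OF keys_scale])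

text \<open>The record is not known to be a group at this stage, so the inverse is computed from its
  definition by description.\<close>

lemma inv_add_monoid:
  assumes "spanned_by M K" "x \<in> carrier M"
  shows "inv\<^bsub>add_monoid M\<^esub> x = - x"
  unfolding m_inv_def
proof (rule the_equality)
  show "- x \<in> carrier (add_monoid M) \<and> x \<otimes>\<^bsub>add_monoid M\<^esub> - x = \<one>\<^bsub>add_monoid M\<^esub> \<and>
     - x \<otimes>\<^bsub>add_monoid M\<^esub> x = \<one>\<^bsub>add_monoid M\<^esub>"
    using assms subspace_ofD(5)[OF subspace_of_UNIV, of x] by (auto simp: spanned_by_def)
qed (use assms in \<open>auto simp: spanned_by_def minus_unique\<close>)

text \<open>Closure under the additive inverse, which \<open>submodule\<close> demands, is scaling
  by -1.\<close>

lemma submodule_iff: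
  assumes "spanned_by M K"
  shows "submodule N CC M \<longleftrightarrow> subspace_of K N"
proof
  assume *: "submodule N CC M"
  then interpret submodule N CC M .
  show "subspace_of K N"
    using subset m_closed one_closed smult_closed[unfolded CC_def] assms
    by (auto simp: spanned_by_def subspace_of_def)
next
  assume *: "subspace_of K N"
  have sub: "N \<subseteq> carrier M"
    using * assms by (auto simp: subspace_of_def spanned_by_def)
  have "inv\<^bsub>add_monoid M\<^esub> x \<in> N" if "x \<in> N" for x
    using that sub inv_add_monoid[OF assms, of x] subspace_ofD(5)[OF *] by auto
  then show "submodule N CC M"
    using * assms sub
    by unfold_locales (auto simp: spanned_by_def subspace_of_def CC_def)
qed

lemma spanned_coset:
  assumes "spanned_by M K"
  shows "N +>\<^bsub>M\<^esub> x = coset N x"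
  using assms by (auto simp: a_r_coset_def' coset_def spanned_by_def)

lemma quot_module_sel:
  "carrier (quot_module M N) = (\<lambda>x. N +>\<^bsub>M\<^esub> x) ` carrier M"
  "zero (quot_module M N) = N"
  "add (quot_module M N) = set_add M"
  "mult (quot_module M N) = rcoset_mult M N"
  "smult (quot_module M N) c X = (\<Union>x\<in>X. N +>\<^bsub>M\<^esub> (c \<odot>\<^bsub>M\<^esub> x))"
  by (auto simp: quot_module_def FactRing_def ring.defs A_RCOSETS_def')

lemma quot_spanned:
  assumes M: "spanned_by M K" and N: "subspace_of K N"
  shows "carrier (quot_module M N) = coset N ` {f. Poly_Mapping.keys f \<subseteq> K}"
    "zero (quot_module M N) = coset N 0"
    "add (quot_module M N) (coset N x) (coset N y) = coset N (x + y)"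
    "smult (quot_module M N) c (coset N x) = coset N (scale c x)"
proof -
  show "carrier (quot_module M N) = coset N ` {f. Poly_Mapping.keys f \<subseteq> K}"
    using M by (simp add: quot_module_sel spanned_coset[OF M] spanned_by_def)
  show "zero (quot_module M N) = coset N 0"
    by (simp add: quot_module_sel coset_def)
  show "add (quot_module M N) (coset N x) (coset N y) = coset N (x + y)"
  proof (rule Set.set_eqI)
    fix z
    have "z \<in> add (quot_module M N) (coset N x) (coset N y) \<longleftrightarrow> (\<exists>a\<in>N. \<exists>b\<in>N. z = a + x + (b + y))"
      using M by (simp add: quot_module_sel set_add_def' coset_def spanned_by_def)
    also have "\<dots> \<longleftrightarrow> (\<exists>c\<in>N. z = c + (x + y))"
    proof
      assume "\<exists>a\<in>N. \<exists>b\<in>N. z = a + x + (b + y)"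
      then obtain a b where "a \<in> N" "b \<in> N" "z = a + x + (b + y)" by blast
      then show "\<exists>c\<in>N. z = c + (x + y)"
        using subspace_ofD(3)[OF N, of a b] by (intro bexI[of _ "a + b"]) (simp_all add: algebra_simps)
    next
      assume "\<exists>c\<in>N. z = c + (x + y)"
      then obtain c where "c \<in> N" "z = c + (x + y)" by blast
      then show "\<exists>a\<in>N. \<exists>b\<in>N. z = a + x + (b + y)"
        using subspace_ofD(2)[OF N] by (intro bexI[of _ c] bexI[of _ 0]) (simp_all add: algebra_simps)
    qed
    also have "\<dots> \<longleftrightarrow> z \<in> coset N (x + y)" by (auto simp: coset_def)
    finally show "z \<in> add (quot_module M N) (coset N x) (coset N y) \<longleftrightarrow> z \<in> coset N (x + y)" .
  qed
  \<comment> \<open>All members of the coset yield the same scaled coset, so the union defining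
    \<open>smult\<close> collapses.\<close>
  have "coset N (scale c z) = coset N (scale c x)" if z: "z \<in> coset N x" for z
  proof -
    obtain n where "n \<in> N" "z = n + x" using z by (auto simp: coset_def)
    then show ?thesis
      using subspace_ofD(4)[OF N, of n c] by (simp add: coset_eq_iff[OF N] scale_add)
  qed
  moreover have "x \<in> coset N x"
    using subspace_ofD(2)[OF N] by (force simp: coset_def)
  ultimately have "(\<Union>z\<in>coset N x. coset N (scale c z)) = coset N (scale c x)" by blast
  then show "smult (quot_module M N) c (coset N x) = coset N (scale c x)"
    using M by (simp add: quot_module_sel spanned_coset[OF M]) (simp add: spanned_by_def)
qed

lemma spanned_free_module: "spanned_by (free_module K) K"
  by (simp add: spanned_by_def free_module_def)

lemma subspace_Inter:
  assumes "N \<in> \<N>" "\<And>N. N \<in> \<N> \<Longrightarrow> subspace_of K N"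
  shows "subspace_of K (\<Inter>\<N>)"
  unfolding subspace_of_def
proof (intro conjI ballI allI)
  show "Poly_Mapping.keys f \<subseteq> K" if "f \<in> \<Inter>\<N>" for f
    using that assms(1) subspace_ofD(1)[OF assms(2)[OF assms(1)]] by blast
qed (use subspace_ofD[OF assms(2)] in auto)

lemma subspace_hull:
  assumes M: "spanned_by M K" and R: "\<And>f. f \<in> R \<Longrightarrow> Poly_Mapping.keys f \<subseteq> K"
  shows "subspace_of K ((\<lambda>N. submodule N CC M) hull R)"
  unfolding hull_def submodule_iff[OF M]
  by (rule subspace_Inter[of "{f. Poly_Mapping.keys f \<subseteq> K}"])
    (use subspace_of_UNIV[of K] R in auto)

text \<open>Relators outside the carrier would make the hull an intersection over the empty family,
  that is, \<open>UNIV\<close>.\<close>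

lemma alg_ideal_hull:
  assumes M: "spanned_by M K" and R: "\<And>f. f \<in> R \<Longrightarrow> Poly_Mapping.keys f \<subseteq> K"
    and mult: "\<And>f g. f \<in> carrier M \<Longrightarrow> g \<in> carrier M \<Longrightarrow> f \<otimes>\<^bsub>M\<^esub> g \<in> carrier M"
  shows "subspace_of K (alg_ideal M hull R)" "alg_ideal M (alg_ideal M hull R)"
    "R \<subseteq> alg_ideal M hull R"
proof -
  have top: "alg_ideal M (carrier M)" "R \<subseteq> carrier M"
    using mult subspace_of_UNIV[of K] M R
    by (auto simp: alg_ideal_def submodule_iff[OF M]) (use R M in \<open>auto simp: spanned_by_def\<close>)
  show sub: "subspace_of K (alg_ideal M hull R)"
    unfolding hull_def by (rule subspace_Inter[of "carrier M"])
      (use top in \<open>auto simp: alg_ideal_def submodule_iff[OF M]\<close>)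
  then show "alg_ideal M (alg_ideal M hull R)"
    by (subst alg_ideal_def, simp add: submodule_iff[OF M]) (auto simp: hull_def alg_ideal_def)
qed (rule hull_subset)

section \<open>Bilinear products and their descent to quotients by ideals\<close>

lemma bilinear_ext_superset:
  assumes "finite A" "finite B" "Poly_Mapping.keys f \<subseteq> A" "Poly_Mapping.keys g \<subseteq> B"
  shows "bilinear_ext m f g = (\<Sum>s\<in>A. \<Sum>t\<in>B. Poly_Mapping.single (m s t)
      (Poly_Mapping.lookup f s * Poly_Mapping.lookup g t))"
proof -
  have "bilinear_ext m f g = (\<Sum>s\<in>Poly_Mapping.keys f. \<Sum>t\<in>B. Poly_Mapping.single (m s t)
      (Poly_Mapping.lookup f s * Poly_Mapping.lookup g t))"
    unfolding bilinear_ext_def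
    by (intro sum.cong refl sum.mono_neutral_left) (use assms in \<open>auto simp: in_keys_iff\<close>)
  also have "\<dots> = (\<Sum>s\<in>A. \<Sum>t\<in>B. Poly_Mapping.single (m s t)
      (Poly_Mapping.lookup f s * Poly_Mapping.lookup g t))"
    by (rule sum.mono_neutral_left) (use assms in \<open>auto simp: in_keys_iff\<close>)
  finally show ?thesis .
qed

lemma bilinear_ext_add_left: "bilinear_ext m (f + f') g = bilinear_ext m f g + bilinear_ext m f' g"
  using bilinear_ext_superset[of "Poly_Mapping.keys f \<union> Poly_Mapping.keys f'" "Poly_Mapping.keys g"]
    Poly_Mapping.keys_add[of f f']
  by (simp add: lookup_add distrib_right single_add sum.distrib)

lemma bilinear_ext_add_right: "bilinear_ext m f (g + g') = bilinear_ext m f g + bilinear_ext m f g'"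
  using bilinear_ext_superset[of "Poly_Mapping.keys f" "Poly_Mapping.keys g \<union> Poly_Mapping.keys g'"]
    Poly_Mapping.keys_add[of g g']
  by (simp add: lookup_add distrib_left single_add sum.distrib)

lemma keys_bilinear_ext:
  assumes "t \<in> Poly_Mapping.keys (bilinear_ext m f g)"
  obtains r s where "r \<in> Poly_Mapping.keys f" "s \<in> Poly_Mapping.keys g" "t = m r s"
proof -
  have "Poly_Mapping.keys (bilinear_ext m f g) \<subseteq>
    (\<Union>r\<in>Poly_Mapping.keys f. \<Union>s\<in>Poly_Mapping.keys g. {m r s})"
    unfolding bilinear_ext_def
    by (intro order_trans[OF Poly_Mapping.keys_sum] UN_mono subset_refl) auto
  with assms that show thesis by blast
qed

text \<open>For a = i + x and b = j + y with i, j in the ideal, ab - xy = ib + xj, and a two-sided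
  ideal absorbs both terms.\<close>

lemma quot_mult:
  assumes M: "spanned_by M K" and I: "alg_ideal M I" and mult: "mult M = bilinear_ext m"
    and x: "Poly_Mapping.keys x \<subseteq> K" and y: "Poly_Mapping.keys y \<subseteq> K"
  shows "mult (quot_module M I) (coset I x) (coset I y) = coset I (bilinear_ext m x y)"
proof -
  have sub: "subspace_of K I" using I by (simp add: alg_ideal_def submodule_iff[OF M])
  have 0: "z \<in> coset I z" for z using subspace_ofD(2)[OF sub] by (force simp: coset_def)
  have "coset I (bilinear_ext m a b) = coset I (bilinear_ext m x y)"
    if ab: "a \<in> coset I x" "b \<in> coset I y" for a b
  proof -
    obtain i where i: "i \<in> I" "a = i + x" using ab(1) by (auto simp: coset_def)
    obtain j where j: "j \<in> I" "b = j + y" using ab(2) by (auto simp: coset_def)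
    note ij = i j
    have diff: "bilinear_ext m a b - bilinear_ext m x y = bilinear_ext m i b + bilinear_ext m x j"
      by (simp add: ij bilinear_ext_add_left bilinear_ext_add_right)
    have "Poly_Mapping.keys b \<subseteq> K"
      unfolding ij using order_trans[OF Poly_Mapping.keys_add[of j y]] y subspace_ofD(1)[OF sub j(1)]
      by simp
    then have "b \<in> carrier M" "x \<in> carrier M"
      using x M by (simp_all add: spanned_by_def)
    then have "bilinear_ext m i b \<in> I" "bilinear_ext m x j \<in> I"
      using I ij mult by (auto simp: alg_ideal_def)
    then show ?thesis using diff subspace_ofD(3)[OF sub] by (simp add: coset_eq_iff[OF sub])
  qed
  moreover have "mult (quot_module M I) (coset I x) (coset I y) =
      (\<Union>a\<in>coset I x. \<Union>b\<in>coset I y. coset I (bilinear_ext m a b))"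
    by (simp add: quot_module_sel rcoset_mult_def spanned_coset[OF M] mult)
  moreover have "(\<Union>a\<in>coset I x. \<Union>b\<in>coset I y. C a b) = D"
    if "\<And>a b. a \<in> coset I x \<Longrightarrow> b \<in> coset I y \<Longrightarrow> C a b = D" for C :: "_ \<Rightarrow> _ \<Rightarrow> ('a \<Rightarrow>\<^sub>0 complex) set" and D
    using that 0[of x] 0[of y] by blast
  ultimately show ?thesis by presburger
qed

section \<open>The relations in \<open>\<pp>\<^sub>n(G)\<close> and its completed enveloping algebra\<close>

lemma keys_basis_subset: "t \<in> K \<Longrightarrow> Poly_Mapping.keys (basis t) \<subseteq> K"
  by simp

lemma keys_add_subset:
  "Poly_Mapping.keys f \<subseteq> K \<Longrightarrow> Poly_Mapping.keys g \<subseteq> K \<Longrightarrow> Poly_Mapping.keys (f + g) \<subseteq> K"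
  for f g :: "'k \<Rightarrow>\<^sub>0 complex"
  using subspace_ofD(3)[OF subspace_of_UNIV] by blast

lemma keys_diff_subset:
  "Poly_Mapping.keys f \<subseteq> K \<Longrightarrow> Poly_Mapping.keys g \<subseteq> K \<Longrightarrow> Poly_Mapping.keys (f - g) \<subseteq> K"
  for f g :: "'k \<Rightarrow>\<^sub>0 complex"
  using subspace_ofD(6)[OF subspace_of_UNIV] by blast

lemma keys_sum_subset:
  "(\<And>a. a \<in> A \<Longrightarrow> Poly_Mapping.keys (h a) \<subseteq> K) \<Longrightarrow> Poly_Mapping.keys (sum h A) \<subseteq> K"
  for h :: "'a \<Rightarrow> 'k \<Rightarrow>\<^sub>0 complex"
  using subspace_of_sum[OF subspace_of_UNIV, of A h K] by blast

lemma keys_scale_subset: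
  "Poly_Mapping.keys f \<subseteq> K \<Longrightarrow> Poly_Mapping.keys (scale c f) \<subseteq> K"
  by (rule order_trans[OF keys_scale])

lemma keys_br_subset:
  assumes "Poly_Mapping.keys f \<subseteq> {t. set_magma t \<subseteq> X}" "Poly_Mapping.keys g \<subseteq> {t. set_magma t \<subseteq> X}"
  shows "Poly_Mapping.keys (br f g) \<subseteq> {t. set_magma t \<subseteq> X}"
proof
  fix t assume "t \<in> Poly_Mapping.keys (br f g)"
  then obtain r s where "r \<in> Poly_Mapping.keys f" "s \<in> Poly_Mapping.keys g" "t = Node r s"
    by (rule keys_bilinear_ext)
  then show "t \<in> {t. set_magma t \<subseteq> X}" using subsetD[OF assms(1), of r] subsetD[OF assms(2), of s] by simp
qed

lemma spanned_magma: "spanned_by (free_magma_algebra X) {t. set_magma t \<subseteq> X}"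
  by (simp add: spanned_by_def free_magma_algebra_def free_module_def)

lemma mult_magma: "mult (free_magma_algebra X) = br"
  by (simp add: free_magma_algebra_def)

lemma spanned_free_algebra: "spanned_by (free_algebra X) (lists X)"
  by (simp add: spanned_by_def free_algebra_def free_module_def)

lemma keys_lie_axioms:
  assumes "f \<in> lie_axioms (free_magma_algebra X)"
  shows "Poly_Mapping.keys f \<subseteq> {t. set_magma t \<subseteq> X}"
proof -
  have car: "carrier (free_magma_algebra X) = {f. Poly_Mapping.keys f \<subseteq> {t. set_magma t \<subseteq> X}}"
    "add (free_magma_algebra X) = (+)"
    using spanned_magma[of X] by (simp_all only: spanned_by_def)
  from assms show ?thesis
    unfolding lie_axioms_def car mult_magma mem_Collect_eq Un_iff
    by (elim disjE exE conjE; hypsubst) (intro keys_add_subset keys_br_subset; assumption)+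
qed

context
  fixes X :: "'x set" and R :: "('x magma \<Rightarrow>\<^sub>0 complex) set"
  assumes R: "\<And>f. f \<in> R \<Longrightarrow> Poly_Mapping.keys f \<subseteq> {t. set_magma t \<subseteq> X}"
begin

lemma lie_relators_keys:
  "f \<in> lie_axioms (free_magma_algebra X) \<union> R \<Longrightarrow> Poly_Mapping.keys f \<subseteq> {t. set_magma t \<subseteq> X}"
  using R keys_lie_axioms by blast

lemma magma_mult_closed:
  "f \<in> carrier (free_magma_algebra X) \<Longrightarrow> g \<in> carrier (free_magma_algebra X) \<Longrightarrow>
    f \<otimes>\<^bsub>free_magma_algebra X\<^esub> g \<in> carrier (free_magma_algebra X)"
  using spanned_magma[of X] keys_br_subset[of f X g] by (simp add: spanned_by_def mult_magma)

lemma lie_ideal: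
  defines "I \<equiv> alg_ideal (free_magma_algebra X) hull (lie_axioms (free_magma_algebra X) \<union> R)"
  shows "subspace_of {t. set_magma t \<subseteq> X} I" "alg_ideal (free_magma_algebra X) I"
    "lie_axioms (free_magma_algebra X) \<union> R \<subseteq> I"
  unfolding I_def
  by (rule alg_ideal_hull[OF spanned_magma lie_relators_keys magma_mult_closed]; assumption)+

lemma lie_class_coset:
  "lie_class X R = coset (alg_ideal (free_magma_algebra X) hull (lie_axioms (free_magma_algebra X) \<union> R))"
  by (simp add: lie_class_def alg_class_def fun_eq_iff spanned_coset[OF spanned_magma])

lemma carrier_lie_presented:
  "carrier (lie_presented X R) = lie_class X R ` {f. Poly_Mapping.keys f \<subseteq> {t. set_magma t \<subseteq> X}}"
  unfolding lie_class_coset lie_presented_def alg_presented_def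
  by (rule quot_spanned[OF spanned_magma lie_ideal(1)])

lemma add_lie_presented: "lie_class X R f \<oplus>\<^bsub>lie_presented X R\<^esub> lie_class X R g = lie_class X R (f + g)"
  unfolding lie_class_coset lie_presented_def alg_presented_def
  by (rule quot_spanned[OF spanned_magma lie_ideal(1)])

lemma smult_lie_presented: "c \<odot>\<^bsub>lie_presented X R\<^esub> lie_class X R f = lie_class X R (scale c f)"
  unfolding lie_class_coset lie_presented_def alg_presented_def
  by (rule quot_spanned[OF spanned_magma lie_ideal(1)])

lemma mult_lie_presented:
  assumes "Poly_Mapping.keys f \<subseteq> {t. set_magma t \<subseteq> X}" "Poly_Mapping.keys g \<subseteq> {t. set_magma t \<subseteq> X}"
  shows "lie_class X R f \<otimes>\<^bsub>lie_presented X R\<^esub> lie_class X R g = lie_class X R (br f g)"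
  unfolding lie_class_coset lie_presented_def alg_presented_def
  by (rule quot_mult[OF spanned_magma lie_ideal(2) mult_magma assms])

lemma lie_class_relator:
  assumes "f \<in> R"
  shows "lie_class X R f = lie_class X R 0"
  unfolding lie_class_coset using assms lie_ideal(3)
  by (subst coset_eq_iff[OF lie_ideal(1)]) auto

lemma lie_presented_closed:
  assumes "x \<in> carrier (lie_presented X R)" "y \<in> carrier (lie_presented X R)"
  shows "x \<oplus>\<^bsub>lie_presented X R\<^esub> y \<in> carrier (lie_presented X R)"
    "c \<odot>\<^bsub>lie_presented X R\<^esub> x \<in> carrier (lie_presented X R)"
    "x \<otimes>\<^bsub>lie_presented X R\<^esub> y \<in> carrier (lie_presented X R)"
proof -
  obtain f where f: "x = lie_class X R f" "Poly_Mapping.keys f \<subseteq> {t. set_magma t \<subseteq> X}"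
    using assms(1) unfolding carrier_lie_presented by blast
  obtain g where g: "y = lie_class X R g" "Poly_Mapping.keys g \<subseteq> {t. set_magma t \<subseteq> X}"
    using assms(2) unfolding carrier_lie_presented by blast
  show "x \<oplus>\<^bsub>lie_presented X R\<^esub> y \<in> carrier (lie_presented X R)"
    using keys_add_subset[OF f(2) g(2)] unfolding f(1) g(1) add_lie_presented carrier_lie_presented by blast
  show "c \<odot>\<^bsub>lie_presented X R\<^esub> x \<in> carrier (lie_presented X R)"
    using keys_scale_subset[OF f(2)] unfolding f(1) smult_lie_presented carrier_lie_presented by blast
  show "x \<otimes>\<^bsub>lie_presented X R\<^esub> y \<in> carrier (lie_presented X R)"
    using keys_br_subset[OF f(2) g(2)]
    unfolding f(1) g(1) mult_lie_presented[OF f(2) g(2)] carrier_lie_presented by blast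
qed

end

section \<open>The enveloping algebra and its grading\<close>

locale closed_lie =
  fixes L :: "(complex, 'l) module"
  assumes add_closed: "x \<in> carrier L \<Longrightarrow> y \<in> carrier L \<Longrightarrow> x \<oplus>\<^bsub>L\<^esub> y \<in> carrier L"
    and smult_closed: "x \<in> carrier L \<Longrightarrow> c \<odot>\<^bsub>L\<^esub> x \<in> carrier L"
    and mult_closed: "x \<in> carrier L \<Longrightarrow> y \<in> carrier L \<Longrightarrow> x \<otimes>\<^bsub>L\<^esub> y \<in> carrier L"
begin

lemma keys_env_relators:
  assumes "f \<in> env_relators L"
  shows "Poly_Mapping.keys f \<subseteq> lists (carrier L)"
proof -
  note rules = keys_diff_subset keys_scale_subset keys_basis_subset
  from assms consider
      x y where "f = basis [x \<oplus>\<^bsub>L\<^esub> y] - basis [x] - basis [y]" "x \<in> carrier L" "y \<in> carrier L"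
    | c x where "f = basis [c \<odot>\<^bsub>L\<^esub> x] - scale c (basis [x])" "x \<in> carrier L"
    | x y where "f = basis [x, y] - basis [y, x] - basis [x \<otimes>\<^bsub>L\<^esub> y]" "x \<in> carrier L" "y \<in> carrier L"
    unfolding env_relators_def Un_iff mem_Collect_eq by blast
  then show ?thesis
    by cases (simp only:, intro rules; simp add: add_closed smult_closed mult_closed)+
qed

lemma free_algebra_mult_closed:
  "f \<in> carrier (free_algebra (carrier L)) \<Longrightarrow> g \<in> carrier (free_algebra (carrier L)) \<Longrightarrow>
    f \<otimes>\<^bsub>free_algebra (carrier L)\<^esub> g \<in> carrier (free_algebra (carrier L))"
proof -
  have "Poly_Mapping.keys (bilinear_ext (@) f g) \<subseteq> lists B"
    if f: "Poly_Mapping.keys f \<subseteq> lists B" and g: "Poly_Mapping.keys g \<subseteq> lists B" for B :: "'l set" and f g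
  proof
    fix xs assume "xs \<in> Poly_Mapping.keys (bilinear_ext (@) f g)"
    then obtain r s where "r \<in> Poly_Mapping.keys f" "s \<in> Poly_Mapping.keys g" "xs = r @ s"
      by (rule keys_bilinear_ext)
    then show "xs \<in> lists B" using subsetD[OF f, of r] subsetD[OF g, of s] by simp
  qed
  then show "f \<in> carrier (free_algebra (carrier L)) \<Longrightarrow> g \<in> carrier (free_algebra (carrier L)) \<Longrightarrow>
    f \<otimes>\<^bsub>free_algebra (carrier L)\<^esub> g \<in> carrier (free_algebra (carrier L))"
    by (simp add: free_algebra_def free_module_def)
qed

lemma env_ideal:
  defines "J \<equiv> alg_ideal (free_algebra (carrier L)) hull env_relators L"
  shows "subspace_of (lists (carrier L)) J" "alg_ideal (free_algebra (carrier L)) J"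
    "env_relators L \<subseteq> J"
  unfolding J_def
  by (rule alg_ideal_hull[OF spanned_free_algebra keys_env_relators free_algebra_mult_closed]; assumption)+

lemma env_class_coset: "env_class L = coset (alg_ideal (free_algebra (carrier L)) hull env_relators L)"
  by (simp add: env_class_def alg_class_def fun_eq_iff spanned_coset[OF spanned_free_algebra])

lemma zero_enveloping: "\<zero>\<^bsub>enveloping L\<^esub> = env_class L 0"
  unfolding env_class_coset enveloping_def alg_presented_def
  by (rule quot_spanned[OF spanned_free_algebra env_ideal(1)])

lemma add_enveloping: "env_class L f \<oplus>\<^bsub>enveloping L\<^esub> env_class L g = env_class L (f + g)"
  unfolding env_class_coset enveloping_def alg_presented_def
  by (rule quot_spanned[OF spanned_free_algebra env_ideal(1)])

lemma smult_enveloping: "c \<odot>\<^bsub>enveloping L\<^esub> env_class L f = env_class L (scale c f)"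
  unfolding env_class_coset enveloping_def alg_presented_def
  by (rule quot_spanned[OF spanned_free_algebra env_ideal(1)])

lemma env_class_add:
  assumes "x \<in> carrier L" "y \<in> carrier L"
  shows "env_class L (basis [x \<oplus>\<^bsub>L\<^esub> y]) = env_class L (basis [x] + basis [y])"
proof -
  have "basis [x \<oplus>\<^bsub>L\<^esub> y] - basis [x] - basis [y] \<in> env_relators L"
    unfolding env_relators_def using assms by blast
  then show ?thesis
    unfolding env_class_coset coset_eq_iff[OF env_ideal(1)] diff_diff_eq[symmetric]
    using env_ideal(3) by blast
qed

text \<open>The degree k part is the image of all functions supported on one set of words, namely
  those of total degree k, so closure reduces to a condition on supports.\<close>

lemma env_graded_closed:
  "\<zero>\<^bsub>enveloping L\<^esub> \<in> env_graded L Lg k"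
  "a \<in> env_graded L Lg k \<Longrightarrow> b \<in> env_graded L Lg k \<Longrightarrow> a \<oplus>\<^bsub>enveloping L\<^esub> b \<in> env_graded L Lg k"
  "a \<in> env_graded L Lg k \<Longrightarrow> c \<odot>\<^bsub>enveloping L\<^esub> a \<in> env_graded L Lg k"
proof -
  let ?C = "{f \<in> carrier (free_algebra (carrier L)).
     \<forall>xs\<in>Poly_Mapping.keys f. \<exists>ds. list_all2 (\<lambda>x d. x \<in> Lg d) xs ds \<and> sum_list ds = k}"
  have C: "?C = {f. Poly_Mapping.keys f \<subseteq> {xs \<in> lists (carrier L).
      \<exists>ds. list_all2 (\<lambda>x d. x \<in> Lg d) xs ds \<and> sum_list ds = k}}"
    using spanned_free_algebra[of "carrier L"] by (auto simp: spanned_by_def)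
  have img: "env_graded L Lg k = env_class L ` ?C" by (simp add: env_graded_def)
  show "\<zero>\<^bsub>enveloping L\<^esub> \<in> env_graded L Lg k"
    unfolding img C zero_enveloping by (rule imageI) simp
  show "c \<odot>\<^bsub>enveloping L\<^esub> a \<in> env_graded L Lg k" if a: "a \<in> env_graded L Lg k"
  proof -
    obtain f where "a = env_class L f" and f: "f \<in> ?C" using a unfolding img by (rule imageE)
    then have "c \<odot>\<^bsub>enveloping L\<^esub> a = env_class L (scale c f)" by (simp only: smult_enveloping)
    moreover have "scale c f \<in> ?C" using f unfolding C by (simp only: mem_Collect_eq keys_scale_subset)
    ultimately show ?thesis unfolding img by (rule image_eqI)
  qed
  show "a \<oplus>\<^bsub>enveloping L\<^esub> b \<in> env_graded L Lg k"
    if a: "a \<in> env_graded L Lg k" and b: "b \<in> env_graded L Lg k"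
  proof -
    obtain f where f: "a = env_class L f" "f \<in> ?C" using a unfolding img by (rule imageE)
    obtain g where g: "b = env_class L g" "g \<in> ?C" using b unfolding img by (rule imageE)
    have "a \<oplus>\<^bsub>enveloping L\<^esub> b = env_class L (f + g)" unfolding f(1) g(1) by (rule add_enveloping)
    moreover have "f + g \<in> ?C" using f(2) g(2) unfolding C by (simp only: mem_Collect_eq keys_add_subset)
    ultimately show ?thesis unfolding img by (rule image_eqI)
  qed
qed

end

text \<open>What is asked of the space of values. \<open>zero_add_zero\<close> serves the degrees in
  which a homogeneous element vanishes, and the proof that a tensor with second factor 0 is
  0.\<close>

locale graded_space =
  fixes A :: "(complex, 'a) module" and Ag :: "nat \<Rightarrow> 'a set"
  assumes zero_graded: "\<zero>\<^bsub>A\<^esub> \<in> Ag k"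
    and add_graded: "a \<in> Ag k \<Longrightarrow> b \<in> Ag k \<Longrightarrow> a \<oplus>\<^bsub>A\<^esub> b \<in> Ag k"
    and smult_graded: "a \<in> Ag k \<Longrightarrow> c \<odot>\<^bsub>A\<^esub> a \<in> Ag k"
    and zero_add_zero: "\<zero>\<^bsub>A\<^esub> \<oplus>\<^bsub>A\<^esub> \<zero>\<^bsub>A\<^esub> = \<zero>\<^bsub>A\<^esub>"

text \<open>The ideals in the presentation are proper hulls only if every relator involves true
  generators. Besides the group laws in G, this uses that the points with nontrivial stabilizer are
  preserved by G.\<close>

lemma keys_pn_relators:
  fixes f :: "'n::finite pgen magma \<Rightarrow>\<^sub>0 complex"
  assumes G: "subgroup G PSU2" and f: "f \<in> pn_relators G"
  shows "Poly_Mapping.keys f \<subseteq> {t. set_magma t \<subseteq> pn_gens G}"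
proof -
  interpret subgroup G PSU2 by (rule G)
  have X2: "Poly_Mapping.keys (X2 i j g) \<subseteq> {t. set_magma t \<subseteq> pn_gens G}"
    if "i \<noteq> j" "g \<in> G" for i j :: 'n and g
    using that by (simp add: pn_gens_def)
  have X1: "Poly_Mapping.keys (X1 i p) \<subseteq> {t. set_magma t \<subseteq> pn_gens G}"
    if "p \<in> - P1_star G" for i :: 'n and p
    using that by (simp add: pn_gens_def)
  have stab: "h \<in> stab G p \<Longrightarrow> h \<in> G" for h p by (simp add: stab_def stabilizer_def)
  have act: "psu2_act g p \<in> - P1_star G" if "g \<in> G" "p \<in> - P1_star G" for g p
    using psu2_act_P1_star[OF G] that by blast
  have S: "Poly_Mapping.keys (\<Sum>h\<in>stab G p. X2 i j (g \<otimes>\<^bsub>PSU2\<^esub> h)) \<subseteq> {t. set_magma t \<subseteq> pn_gens G}"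
    if "i \<noteq> j" "g \<in> G" for i j :: 'n and g p
    by (intro keys_sum_subset X2 that m_closed stab)
  from f show ?thesis
    unfolding pn_relators_def Un_iff mem_Collect_eq
  proof (elim disjE exE conjE, goal_cases)
    case (1 i j g)
    show ?case
      unfolding 1(1) by (rule keys_diff_subset[OF X2[OF 1(2,3)] X2[OF 1(2)[symmetric] m_inv_closed[OF 1(3)]]])
  next
    case (2 i)
    show ?case
      unfolding 2(1)
    proof (rule keys_add_subset; rule keys_sum_subset)
      show "Poly_Mapping.keys (\<Sum>g\<in>G. X2 i m g) \<subseteq> {t. set_magma t \<subseteq> pn_gens G}" if "m \<in> - {i}" for m
        using that by (intro keys_sum_subset X2) simp_all
    qed (rule X1)
  next
    case (3 i j k l g g')
    then have "i \<noteq> j" "k \<noteq> l" by simp_all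
    show ?case unfolding 3(1) by (rule keys_br_subset[OF X2[OF \<open>i \<noteq> j\<close> 3(3)] X2[OF \<open>k \<noteq> l\<close> 3(4)]])
  next
    case (4 i j k g g')
    then have "i \<noteq> j" "k \<noteq> j" "k \<noteq> i" by auto
    show ?case
      unfolding 4(1)
      by (rule keys_br_subset[OF X2[OF \<open>i \<noteq> j\<close> 4(3)]
          keys_add_subset[OF X2[OF \<open>k \<noteq> j\<close> m_closed[OF 4(4,3)]] X2[OF \<open>k \<noteq> i\<close> 4(4)]]])
  next
    case (5 i j k p g')
    then have "j \<noteq> k" by simp
    show ?case unfolding 5(1) by (rule keys_br_subset[OF X1[OF 5(3)] X2[OF \<open>j \<noteq> k\<close> 5(4)]])
  next
    case (6 i j p q)
    then have q: "q \<in> - P1_star G" by blast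
    show ?case unfolding 6(1) by (rule keys_br_subset[OF X1[OF 6(3)] X1[OF q]])
  next
    case (7 i j g p)
    show ?case
      unfolding 7(1)
      by (intro keys_br_subset[OF X2[OF 7(2,3)]] keys_add_subset X1[OF 7(4)] X1[OF act[OF 7(3,4)]] S[OF 7(2,3)])
  next
    case (8 i j g p)
    show ?case
      unfolding 8(1)
      by (rule keys_br_subset[OF X1[OF 8(4)] keys_add_subset[OF X1[OF act[OF 8(3,4)]] S[OF 8(2,3)]]])
  qed
qed

text \<open>Extends \<open>Upn_gen\<close> from generators to combinations of them. A relator is one
  element of the free algebra; this map allows its class to be split into the classes of its
  terms.\<close>

definition Upn_lin :: "psu2 set \<Rightarrow> ('n::finite pgen magma \<Rightarrow>\<^sub>0 complex) \<Rightarrow> nat \<Rightarrow> 'n Upn" where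
  "Upn_lin G c = homogeneous (Upn G) 1
     (env_class (pn G) (basis [lie_class (pn_gens G) (pn_relators G) c]))"

lemma Upn_gen_eq: "Upn_gen G x = Upn_lin G (basis (Leaf x))"
  by (simp add: Upn_gen_def Upn_lin_def)

section \<open>Linear relations among the generators in the completed enveloping algebra\<close>

context
  fixes G :: "psu2 set"
  assumes G: "subgroup G PSU2"
begin

lemma closed_lie_pn: "closed_lie (pn G :: (complex, 'n::finite pn) module)"
  unfolding pn_def
proof
  let ?L = "lie_presented (pn_gens G) (pn_relators G) :: (complex, 'n pn) module"
  have *: "x \<oplus>\<^bsub>?L\<^esub> y \<in> carrier ?L" "c \<odot>\<^bsub>?L\<^esub> x \<in> carrier ?L" "x \<otimes>\<^bsub>?L\<^esub> y \<in> carrier ?L"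
    if "x \<in> carrier ?L" "y \<in> carrier ?L" for x y c
    by (rule lie_presented_closed[OF _ that], rule keys_pn_relators[OF G], assumption)+
  show "x \<oplus>\<^bsub>?L\<^esub> y \<in> carrier ?L" "x \<otimes>\<^bsub>?L\<^esub> y \<in> carrier ?L"
    if "x \<in> carrier ?L" "y \<in> carrier ?L" for x y using that by (rule *)+
  show "c \<odot>\<^bsub>?L\<^esub> x \<in> carrier ?L" if "x \<in> carrier ?L" for x c using that that by (rule *)
qed

lemma graded_space_Upn: "graded_space (Upn G :: (complex, 'n::finite Upn) module) (Upn_graded G)"
proof -
  interpret closed_lie "pn G :: (complex, 'n::finite pn) module" by (rule closed_lie_pn)
  show ?thesis
    unfolding Upn_def Upn_graded_def
    by unfold_locales
      ((rule env_graded_closed; assumption) | simp add: zero_enveloping add_enveloping smult_enveloping)+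
qed

definition gens_span :: "('n::finite pgen magma \<Rightarrow>\<^sub>0 complex) set" where
  "gens_span = {c. Poly_Mapping.keys c \<subseteq> Leaf ` pn_gens G}"

lemma gens_span_lie:
  assumes "c \<in> gens_span"
  shows "lie_class (pn_gens G) (pn_relators G) c \<in> carrier (pn G :: (complex, 'n::finite pn) module)"
    "lie_class (pn_gens G) (pn_relators G) c \<in> (pn_graded G 1 :: 'n pn set)"
proof -
  have c: "Poly_Mapping.keys c \<subseteq> {t. set_magma t \<subseteq> pn_gens G}"
    by (rule order_trans[OF assms[unfolded gens_span_def mem_Collect_eq]]) auto
  have "carrier (pn G) = lie_class (pn_gens G) (pn_relators G) `
      {f :: 'n pgen magma \<Rightarrow>\<^sub>0 complex. Poly_Mapping.keys f \<subseteq> {t. set_magma t \<subseteq> pn_gens G}}"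
    unfolding pn_def by (rule carrier_lie_presented, rule keys_pn_relators[OF G])
  then show "lie_class (pn_gens G) (pn_relators G) c \<in> carrier (pn G :: (complex, 'n::finite pn) module)"
    using c by simp
  show "lie_class (pn_gens G) (pn_relators G) c \<in> (pn_graded G 1 :: 'n pn set)"
    unfolding pn_graded_def lie_graded_def
  proof (rule imageI, rule CollectI, rule conjI)
    show "c \<in> carrier (free_magma_algebra (pn_gens G))"
      using c spanned_magma[of "pn_gens G :: 'n pgen set"] by (simp only: spanned_by_def mem_Collect_eq)
    show "\<forall>t\<in>Poly_Mapping.keys c. leaves t = 1"
    proof
      fix t assume "t \<in> Poly_Mapping.keys c"
      then have "t \<in> Leaf ` pn_gens G"
        using assms unfolding gens_span_def by (simp only: mem_Collect_eq subset_eq)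
      then show "leaves t = 1" by (rule imageE) simp
    qed
  qed
qed

text \<open>Additivity passes through three layers: the Lie quotient; the relators that make a
  letter of the free algebra additive in its label; and the completion, where both sides are zero
  outside degree 1.\<close>

lemma Upn_lin_add:
  fixes c d :: "'n::finite pgen magma \<Rightarrow>\<^sub>0 complex"
  assumes "c \<in> gens_span" "d \<in> gens_span"
  shows "Upn_lin G (c + d) =
    Upn_lin G c \<oplus>\<^bsub>graded_completion (Upn G :: (complex, 'n::finite Upn) module) (Upn_graded G)\<^esub> Upn_lin G d"
proof -
  interpret closed_lie "pn G :: (complex, 'n::finite pn) module" by (rule closed_lie_pn)
  interpret graded_space "Upn G :: (complex, 'n::finite Upn) module" "Upn_graded G"
    by (rule graded_space_Upn)
  have "lie_class (pn_gens G) (pn_relators G) (c + d) =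
      lie_class (pn_gens G) (pn_relators G) c \<oplus>\<^bsub>pn G\<^esub> lie_class (pn_gens G) (pn_relators G) d"
    unfolding pn_def by (rule sym, rule add_lie_presented, rule keys_pn_relators[OF G])
  then have "env_class (pn G) (basis [lie_class (pn_gens G) (pn_relators G) (c + d)]) =
      env_class (pn G) (basis [lie_class (pn_gens G) (pn_relators G) c] +
        basis [lie_class (pn_gens G) (pn_relators G) d])"
    by (simp only: env_class_add[OF gens_span_lie(1)[OF assms(1)] gens_span_lie(1)[OF assms(2)]])
  also have "\<dots> = env_class (pn G) (basis [lie_class (pn_gens G) (pn_relators G) c]) \<oplus>\<^bsub>Upn G\<^esub>
      env_class (pn G) (basis [lie_class (pn_gens G) (pn_relators G) d])"
    unfolding Upn_def by (rule add_enveloping[symmetric])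
  finally have "homogeneous (Upn G) 1 (env_class (pn G) (basis [lie_class (pn_gens G) (pn_relators G) (c + d)])) k =
      homogeneous (Upn G) 1 (env_class (pn G) (basis [lie_class (pn_gens G) (pn_relators G) c])) k \<oplus>\<^bsub>Upn G\<^esub>
      homogeneous (Upn G) 1 (env_class (pn G) (basis [lie_class (pn_gens G) (pn_relators G) d])) k" for k
    unfolding homogeneous_def by (cases "k = 1") (simp_all only: simp_thms if_True if_False zero_add_zero)
  then show ?thesis
    unfolding Upn_lin_def graded_completion_def ring.simps by (rule ext)
qed

lemma Upn_lin_carrier:
  fixes c :: "'n::finite pgen magma \<Rightarrow>\<^sub>0 complex"
  assumes "c \<in> gens_span"
  shows "Upn_lin G c \<in> carrier (graded_completion (Upn G :: (complex, 'n Upn) module) (Upn_graded G))"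
proof -
  interpret graded_space "Upn G :: (complex, 'n::finite Upn) module" "Upn_graded G"
    by (rule graded_space_Upn)
  let ?x = "lie_class (pn_gens G) (pn_relators G) c"
  have "env_class (pn G) (basis [?x]) \<in> Upn_graded G 1"
    unfolding Upn_graded_def env_graded_def
  proof (rule imageI, rule CollectI, rule conjI)
    show "basis [?x] \<in> carrier (free_algebra (carrier (pn G)))"
      using gens_span_lie(1)[OF assms] by (simp add: free_algebra_def free_module_def)
    show "\<forall>xs\<in>Poly_Mapping.keys (basis [?x]).
        \<exists>ds. list_all2 (\<lambda>x d. x \<in> pn_graded G d) xs ds \<and> sum_list ds = 1"
      using gens_span_lie(2)[OF assms] by (auto intro!: exI[of _ "[1]"])
  qed
  then have "homogeneous (Upn G) 1 (env_class (pn G) (basis [?x])) k \<in> Upn_graded G k" for k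
    unfolding homogeneous_def using zero_graded by (cases "k = 1") (simp_all only: simp_thms if_True if_False)
  then show ?thesis
    unfolding Upn_lin_def graded_completion_def partial_object.simps by blast
qed

text \<open>The one-letter word whose letter is the zero x of the Lie algebra is a nonzero basis
  vector. Its class vanishes because x + x = x turns the additivity relator into minus that
  word.\<close>

lemma Upn_lin_zero:
  "(Upn_lin G (0 :: 'n::finite pgen magma \<Rightarrow>\<^sub>0 complex)) =
    \<zero>\<^bsub>graded_completion (Upn G :: (complex, 'n::finite Upn) module) (Upn_graded G)\<^esub>"
proof -
  interpret closed_lie "pn G :: (complex, 'n::finite pn) module" by (rule closed_lie_pn)
  let ?x = "lie_class (pn_gens G) (pn_relators G) 0 :: 'n pn"
  have car: "?x \<in> carrier (pn G)"
    by (rule gens_span_lie) (simp add: gens_span_def)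
  have "?x \<oplus>\<^bsub>pn G\<^esub> ?x = ?x"
    unfolding pn_def by (subst add_lie_presented) (simp_all add: keys_pn_relators[OF G])
  then have "env_class (pn G) (basis [?x]) = env_class (pn G) (basis [?x] + basis [?x])"
    using env_class_add[OF car car] by simp
  then have "env_class (pn G) (basis [?x]) = env_class (pn G) 0"
    unfolding env_class_coset coset_eq_iff[OF env_ideal(1)]
    using subspace_ofD(5)[OF env_ideal(1), of "basis [?x] - (basis [?x] + basis [?x])"] by simp
  also have "\<dots> = \<zero>\<^bsub>Upn G\<^esub>" unfolding Upn_def by (rule zero_enveloping[symmetric])
  finally show ?thesis
    unfolding Upn_lin_def by (simp only: homogeneous_def graded_completion_def ring.simps if_cancel)
qed

lemma Upn_lin_relator:
  fixes f :: "'n::finite pgen magma \<Rightarrow>\<^sub>0 complex"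
  assumes "f \<in> pn_relators G"
  shows "Upn_lin G f = \<zero>\<^bsub>graded_completion (Upn G :: (complex, 'n::finite Upn) module) (Upn_graded G)\<^esub>"
proof -
  have "lie_class (pn_gens G) (pn_relators G) f = lie_class (pn_gens G) (pn_relators G) 0"
    by (rule lie_class_relator[OF keys_pn_relators[OF G] assms])
  then show ?thesis by (simp add: Upn_lin_def flip: Upn_lin_zero)
qed

end

section \<open>Completed tensor products\<close>

locale tensor_space =
  fixes V :: "(complex, 'v) module" and W :: "(complex, 'w) module"
  assumes V_add: "v \<in> carrier V \<Longrightarrow> v' \<in> carrier V \<Longrightarrow> v \<oplus>\<^bsub>V\<^esub> v' \<in> carrier V"
    and V_smult: "v \<in> carrier V \<Longrightarrow> c \<odot>\<^bsub>V\<^esub> v \<in> carrier V"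
    and W_add: "w \<in> carrier W \<Longrightarrow> w' \<in> carrier W \<Longrightarrow> w \<oplus>\<^bsub>W\<^esub> w' \<in> carrier W"
    and W_smult: "w \<in> carrier W \<Longrightarrow> c \<odot>\<^bsub>W\<^esub> w \<in> carrier W"
begin

lemma keys_bilinear_relators:
  assumes "f \<in> bilinear_relators V W"
  shows "Poly_Mapping.keys f \<subseteq> carrier V \<times> carrier W"
  using assms unfolding bilinear_relators_def Un_iff mem_Collect_eq
  by (elim disjE exE conjE; hypsubst)
    (intro keys_diff_subset keys_scale_subset keys_basis_subset SigmaI V_add V_smult W_add W_smult; assumption)+

lemma subspace_tensor_kernel: "subspace_of (carrier V \<times> carrier W) (tensor_kernel V W)"
  unfolding tensor_kernel_def by (rule subspace_hull[OF spanned_free_module keys_bilinear_relators])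

lemma bilinear_relators_kernel: "f \<in> bilinear_relators V W \<Longrightarrow> f \<in> tensor_kernel V W"
  unfolding tensor_kernel_def by (rule hull_inc)

lemma tensor_kernel_least:
  assumes "subspace_of (carrier V \<times> carrier W) N" "bilinear_relators V W \<subseteq> N"
  shows "tensor_kernel V W \<subseteq> N"
  unfolding tensor_kernel_def
  by (rule hull_minimal[OF assms(2)]) (simp add: submodule_iff[OF spanned_free_module] assms(1))

lemma tensor_class_coset: "tensor_class V W = coset (tensor_kernel V W)"
  by (simp add: tensor_class_def fun_eq_iff spanned_coset[OF spanned_free_module])

lemmas tensor_simps =
  quot_spanned[OF spanned_free_module subspace_tensor_kernel, folded tensor_def tensor_class_coset]

lemma tensor_class_eq_iff: "tensor_class V W f = tensor_class V W g \<longleftrightarrow> f - g \<in> tensor_kernel V W"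
  unfolding tensor_class_coset by (rule coset_eq_iff[OF subspace_tensor_kernel])

lemma mem_tensor_class_iff: "g \<in> tensor_class V W f \<longleftrightarrow> g - f \<in> tensor_kernel V W"
  by (auto simp: tensor_class_coset coset_def image_iff algebra_simps) (metis diff_add_cancel)

text \<open>Minimality of the hull: the elements sent into the target kernel form a subspace, and a
  linear \<phi> sends each bilinear relator to a relator of the same family.\<close>

lemma push_tensor_kernel:
  fixes V' :: "(complex, 'v') module"
  assumes V': "tensor_space V' W"
    and car: "\<And>v. v \<in> carrier V \<Longrightarrow> \<phi> v \<in> carrier V'"
    and add: "\<And>v v'. v \<in> carrier V \<Longrightarrow> v' \<in> carrier V \<Longrightarrow> \<phi> (v \<oplus>\<^bsub>V\<^esub> v') = \<phi> v \<oplus>\<^bsub>V'\<^esub> \<phi> v'"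
    and smult: "\<And>c v. v \<in> carrier V \<Longrightarrow> \<phi> (c \<odot>\<^bsub>V\<^esub> v) = c \<odot>\<^bsub>V'\<^esub> \<phi> v"
    and f: "f \<in> tensor_kernel V W"
  shows "pm_map (\<lambda>(v, w). (\<phi> v, w)) f \<in> tensor_kernel V' W"
proof -
  interpret V': tensor_space V' W by (rule V')
  let ?N = "{f. Poly_Mapping.keys f \<subseteq> carrier V \<times> carrier W \<and>
    pm_map (\<lambda>(v, w). (\<phi> v, w)) f \<in> tensor_kernel V' W}"
  have "tensor_kernel V W \<subseteq> ?N"
  proof (rule tensor_kernel_least)
    show "subspace_of (carrier V \<times> carrier W) ?N"
      unfolding subspace_of_def
      using subspace_ofD[OF V'.subspace_tensor_kernel]
      by (simp add: keys_add_subset keys_scale_subset pm_map_add pm_map_scale)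
    have "pm_map (\<lambda>(v, w). (\<phi> v, w)) f \<in> bilinear_relators V' W" if "f \<in> bilinear_relators V W" for f
      using that unfolding bilinear_relators_def Un_iff mem_Collect_eq
      apply (elim disjE exE conjE; hypsubst)
         apply (simp_all add: pm_map_minus pm_map_scale add smult)
         apply (metis car)+
      done
    then show "bilinear_relators V W \<subseteq> ?N"
      using keys_bilinear_relators V'.bilinear_relators_kernel by blast
  qed
  then show ?thesis using f by blast
qed

end

section \<open>The completion of a tensor product filtered through its second factor\<close>

locale filtered_tensor = tensor_space V W
  for V :: "(complex, 'v) module" and W :: "(complex, 'w) module" +
  fixes Wk :: "nat \<Rightarrow> 'w set"
  assumes Wk_subset: "Wk k \<subseteq> carrier W" and Wk_decreasing: "Wk (Suc k) \<subseteq> Wk k"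
begin

abbreviation "T \<equiv> tensor V W"
abbreviation "F k \<equiv> tensor_image V W (Wk k)"

text \<open>The image of f in the quotient of the tensor product by \<open>F k\<close>, a coset of
  cosets. Spelling it out by representatives reduces computations in the completion to finitely
  supported functions.\<close>

definition jet :: "nat \<Rightarrow> ('v \<times> 'w \<Rightarrow>\<^sub>0 complex) \<Rightarrow> ('v \<times> 'w \<Rightarrow>\<^sub>0 complex) set set" where
  "jet k f = {tensor_class V W (f + u) | u. Poly_Mapping.keys u \<subseteq> carrier V \<times> Wk k}"

lemma jet_eq: "F k +>\<^bsub>T\<^esub> tensor_class V W f = jet k f"
  unfolding a_r_coset_def' tensor_image_def jet_def
  by (auto simp: tensor_simps add.commute)

lemma jet_0: "F k = jet k 0"
  by (auto simp: tensor_image_def jet_def)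

lemma jet_cong: "f - g \<in> tensor_kernel V W \<Longrightarrow> jet k f = jet k g"
  unfolding jet_eq[symmetric] using tensor_class_eq_iff by metis

lemma jet_add: "jet k f <+>\<^bsub>T\<^esub> jet k g = jet k (f + g)"
proof (rule Set.set_eqI)
  fix z
  have "z \<in> jet k f <+>\<^bsub>T\<^esub> jet k g \<longleftrightarrow> (\<exists>x\<in>jet k f. \<exists>y\<in>jet k g. z = x \<oplus>\<^bsub>T\<^esub> y)"
    by (simp add: set_add_def')
  also have "\<dots> \<longleftrightarrow> (\<exists>u v. Poly_Mapping.keys u \<subseteq> carrier V \<times> Wk k \<and> Poly_Mapping.keys v \<subseteq> carrier V \<times> Wk k \<and>
      z = tensor_class V W (f + u) \<oplus>\<^bsub>T\<^esub> tensor_class V W (g + v))"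
    unfolding jet_def by blast
  also have "\<dots> \<longleftrightarrow> (\<exists>u v. Poly_Mapping.keys u \<subseteq> carrier V \<times> Wk k \<and> Poly_Mapping.keys v \<subseteq> carrier V \<times> Wk k \<and>
      z = tensor_class V W (f + u + (g + v)))"
    by (simp only: tensor_simps)
  also have "\<dots> \<longleftrightarrow> (\<exists>u. Poly_Mapping.keys u \<subseteq> carrier V \<times> Wk k \<and> z = tensor_class V W (f + g + u))"
  proof safe
    fix u v :: "'v \<times> 'w \<Rightarrow>\<^sub>0 complex"
    assume "Poly_Mapping.keys u \<subseteq> carrier V \<times> Wk k" "Poly_Mapping.keys v \<subseteq> carrier V \<times> Wk k"
    then show "\<exists>w. Poly_Mapping.keys w \<subseteq> carrier V \<times> Wk k \<and>
        tensor_class V W (f + u + (g + v)) = tensor_class V W (f + g + w)"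
      by (intro exI[of _ "u + v"]) (simp add: keys_add_subset algebra_simps)
  next
    fix u :: "'v \<times> 'w \<Rightarrow>\<^sub>0 complex"
    assume "Poly_Mapping.keys u \<subseteq> carrier V \<times> Wk k"
    then show "\<exists>u' v. Poly_Mapping.keys u' \<subseteq> carrier V \<times> Wk k \<and> Poly_Mapping.keys v \<subseteq> carrier V \<times> Wk k \<and>
        tensor_class V W (f + g + u) = tensor_class V W (f + u' + (g + v))"
      by (intro exI[of _ u] exI[of _ 0]) (simp add: algebra_simps)
  qed
  also have "\<dots> \<longleftrightarrow> z \<in> jet k (f + g)" by (auto simp: jet_def)
  finally show "z \<in> jet k f <+>\<^bsub>T\<^esub> jet k g \<longleftrightarrow> z \<in> jet k (f + g)" .
qed

lemma tensor_class_mem_jet: "tensor_class V W f \<in> jet k f"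
  unfolding jet_def by (intro CollectI exI[of _ 0]) simp

lemma jet_eqD:
  assumes "jet k f = jet k g"
  obtains u where "Poly_Mapping.keys u \<subseteq> carrier V \<times> Wk k" "f - g - u \<in> tensor_kernel V W"
proof -
  from assms tensor_class_mem_jet[of f k] obtain u
    where "Poly_Mapping.keys u \<subseteq> carrier V \<times> Wk k" "tensor_class V W f = tensor_class V W (g + u)"
    by (auto simp: jet_def)
  then show thesis using that[of u] by (simp add: tensor_class_eq_iff diff_diff_eq)
qed

lemma jet_absorb:
  assumes "Poly_Mapping.keys u \<subseteq> carrier V \<times> Wk k"
  shows "jet k (f + u) = jet k f"
proof (rule Set.set_eqI, rule iffI)
  fix z assume "z \<in> jet k (f + u)"
  then obtain v where "Poly_Mapping.keys v \<subseteq> carrier V \<times> Wk k" "z = tensor_class V W (f + u + v)"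
    by (auto simp: jet_def)
  then show "z \<in> jet k f"
    unfolding jet_def using assms
    by (intro CollectI exI[of _ "u + v"]) (simp add: keys_add_subset algebra_simps)
next
  fix z assume "z \<in> jet k f"
  then obtain v where "Poly_Mapping.keys v \<subseteq> carrier V \<times> Wk k" "z = tensor_class V W (f + v)"
    by (auto simp: jet_def)
  then show "z \<in> jet k (f + u)"
    unfolding jet_def using assms
    by (intro CollectI exI[of _ "v - u"]) (simp add: keys_diff_subset algebra_simps)
qed

abbreviation "free \<equiv> {f. Poly_Mapping.keys f \<subseteq> carrier V \<times> carrier W}"

lemma completion_sel:
  "carrier (completion T F) = {c. \<forall>k. c k \<in> jet k ` free \<and> c (Suc k) \<subseteq> c k}"
  "\<zero>\<^bsub>completion T F\<^esub> = (\<lambda>k. jet k 0)"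
  "c \<oplus>\<^bsub>completion T F\<^esub> d = (\<lambda>k. c k <+>\<^bsub>T\<^esub> d k)"
proof -
  have "carrier (quot_module T (F k)) = jet k ` free" for k
    by (simp add: quot_module_sel tensor_simps image_image jet_eq)
  then show "carrier (completion T F) = {c. \<forall>k. c k \<in> jet k ` free \<and> c (Suc k) \<subseteq> c k}"
    by (simp add: completion_def)
qed (simp_all add: completion_def quot_module_sel jet_0)

text \<open>The canonical map from the tensor product to its completion; compatibility of successive
  levels is the decrease of \<open>Wk\<close>.\<close>

lemma jets_carrier:
  assumes "f \<in> free"
  shows "(\<lambda>k. jet k f) \<in> carrier (completion T F)"
  using assms Wk_decreasing unfolding completion_sel(1) by (auto simp: jet_def) blast

text \<open>Needed before \<open>finsum\<close> can be evaluated term by term. The axioms are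
  checked at each level, on representatives that depend on the level.\<close>

lemma abelian_monoid_completion: "abelian_monoid (completion T F)"
proof (rule abelian_monoidI)
  have form: "\<exists>f\<in>free. c k = jet k f" if "c \<in> carrier (completion T F)" for c k
    using that unfolding completion_sel(1) by blast
  show "\<zero>\<^bsub>completion T F\<^esub> \<in> carrier (completion T F)"
    using jets_carrier[of 0] by (simp add: completion_sel(2))
  fix c d assume c: "c \<in> carrier (completion T F)" and d: "d \<in> carrier (completion T F)"
  have "c k <+>\<^bsub>T\<^esub> d k \<in> jet k ` free" for k
  proof -
    obtain f where f: "f \<in> free" "c k = jet k f" using form[OF c] by blast
    obtain g where g: "g \<in> free" "d k = jet k g" using form[OF d] by blast
    have "f + g \<in> free" using f(1) g(1) by (simp only: mem_Collect_eq keys_add_subset)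
    then show ?thesis unfolding f(2) g(2) jet_add by (rule imageI)
  qed
  moreover have "c (Suc k) <+>\<^bsub>T\<^esub> d (Suc k) \<subseteq> c k <+>\<^bsub>T\<^esub> d k" for k
    using c d unfolding completion_sel(1) set_add_def' by blast
  ultimately show "c \<oplus>\<^bsub>completion T F\<^esub> d \<in> carrier (completion T F)"
    unfolding completion_sel by blast
  have "c k <+>\<^bsub>T\<^esub> d k = d k <+>\<^bsub>T\<^esub> c k" for k
    using form[OF c, of k] form[OF d, of k] by (auto simp: jet_add add.commute)
  then show "c \<oplus>\<^bsub>completion T F\<^esub> d = d \<oplus>\<^bsub>completion T F\<^esub> c" by (simp add: completion_sel)
  have "jet k 0 <+>\<^bsub>T\<^esub> c k = c k" for k
    using form[OF c, of k] by (auto simp: jet_add)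
  then show "\<zero>\<^bsub>completion T F\<^esub> \<oplus>\<^bsub>completion T F\<^esub> c = c" by (simp add: completion_sel)
  fix e assume e: "e \<in> carrier (completion T F)"
  have "c k <+>\<^bsub>T\<^esub> d k <+>\<^bsub>T\<^esub> e k = c k <+>\<^bsub>T\<^esub> (d k <+>\<^bsub>T\<^esub> e k)" for k
    using form[OF c, of k] form[OF d, of k] form[OF e, of k] by (auto simp: jet_add add.assoc)
  then show "c \<oplus>\<^bsub>completion T F\<^esub> d \<oplus>\<^bsub>completion T F\<^esub> e = c \<oplus>\<^bsub>completion T F\<^esub> (d \<oplus>\<^bsub>completion T F\<^esub> e)"
    by (simp add: completion_sel)
qed

lemma finsum_jets:
  assumes "finite A" "\<And>a. a \<in> A \<Longrightarrow> h a \<in> free"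
  shows "finsum (completion T F) (\<lambda>a k. jet k (h a)) A = (\<lambda>k. jet k (sum h A))"
  using assms
proof (induction A rule: finite_induct)
  case empty
  interpret abelian_monoid "completion T F" by (rule abelian_monoid_completion)
  show ?case by (simp add: completion_sel(2))
next
  case (insert a A)
  interpret abelian_monoid "completion T F" by (rule abelian_monoid_completion)
  have "finsum (completion T F) (\<lambda>a k. jet k (h a)) (insert a A) =
      (\<lambda>k. jet k (h a)) \<oplus>\<^bsub>completion T F\<^esub> finsum (completion T F) (\<lambda>a k. jet k (h a)) A"
    by (rule finsum_insert) (use insert jets_carrier in auto)
  then show ?case using insert by (simp add: completion_sel(3) jet_add)
qed

text \<open>Asking for the equation on the index set only makes the rule fit nested sums, whose
  inner sums have themselves to be rewritten as jets.\<close>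

lemma finsum_eq_jets:
  assumes "finite A" "\<And>a. a \<in> A \<Longrightarrow> h a \<in> free" "\<And>a. a \<in> A \<Longrightarrow> H a = (\<lambda>k. jet k (h a))"
  shows "finsum (completion T F) H A = (\<lambda>k. jet k (sum h A))"
proof -
  interpret abelian_monoid "completion T F" by (rule abelian_monoid_completion)
  have "finsum (completion T F) H A = finsum (completion T F) (\<lambda>a k. jet k (h a)) A"
    by (rule finsum_cong') (use assms jets_carrier in auto)
  then show ?thesis using finsum_jets[of A h] assms by simp
qed

end

section \<open>Maps induced on completed tensor products by linear maps of the first factor\<close>

locale tensor_hom = V: filtered_tensor V W Wk + V': filtered_tensor V' W Wk
  for V :: "(complex, 'v) module" and V' :: "(complex, 'u) module"
    and W :: "(complex, 'w) module" and Wk +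
  fixes \<phi> :: "'v \<Rightarrow> 'u"
  assumes hom_closed: "v \<in> carrier V \<Longrightarrow> \<phi> v \<in> carrier V'"
    and hom_add: "v \<in> carrier V \<Longrightarrow> v' \<in> carrier V \<Longrightarrow> \<phi> (v \<oplus>\<^bsub>V\<^esub> v') = \<phi> v \<oplus>\<^bsub>V'\<^esub> \<phi> v'"
    and hom_smult: "v \<in> carrier V \<Longrightarrow> \<phi> (c \<odot>\<^bsub>V\<^esub> v) = c \<odot>\<^bsub>V'\<^esub> \<phi> v"
begin

abbreviation push where "push \<equiv> pm_map (\<lambda>(v, w). (\<phi> v, w))"

lemma push_kernel: "f \<in> tensor_kernel V W \<Longrightarrow> push f \<in> tensor_kernel V' W"
  by (rule V.push_tensor_kernel[OF V'.tensor_space_axioms hom_closed hom_add hom_smult])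

lemma push_keys:
  assumes "Poly_Mapping.keys f \<subseteq> carrier V \<times> B"
  shows "Poly_Mapping.keys (push f) \<subseteq> carrier V' \<times> B"
  using order_trans[OF keys_pm_map image_mono[OF assms]] hom_closed by fastforce

lemma tensor_map_class: "tensor_map V' W \<phi> (tensor_class V W f) = tensor_class V' W (push f)"
proof -
  have map: "tensor_map V' W \<phi> x = (\<Union>g\<in>x. tensor_class V' W (push g))" for x
    unfolding tensor_map_def pm_map_def by (simp add: case_prod_unfold)
  have "tensor_class V' W (push g) = tensor_class V' W (push f)" if "g \<in> tensor_class V W f" for g
    using push_kernel[of "g - f"] that
    by (simp add: V'.tensor_class_eq_iff V.mem_tensor_class_iff pm_map_minus)
  moreover have "f \<in> tensor_class V W f"
    using subspace_ofD(2)[OF V.subspace_tensor_kernel] by (simp add: V.mem_tensor_class_iff)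
  ultimately show ?thesis unfolding map by blast
qed

text \<open>Only level k enters, so the rule also applies to elements of the completion that have no
  representative common to all levels.\<close>

lemma completion_map_jets:
  assumes "c k = V.jet k f"
  shows "completion_map (tensor V' W) (\<lambda>k. tensor_image V' W (Wk k)) (tensor_map V' W \<phi>) c k = V'.jet k (push f)"
proof -
  have "tensor_image V' W (Wk k) +>\<^bsub>tensor V' W\<^esub> tensor_map V' W \<phi> x = V'.jet k (push f)"
    if x: "x \<in> V.jet k f" for x
  proof -
    obtain u where u: "Poly_Mapping.keys u \<subseteq> carrier V \<times> Wk k" "x = tensor_class V W (f + u)"
      using x by (auto simp: V.jet_def)
    show ?thesis
      by (simp add: u(2) tensor_map_class V'.jet_eq pm_map_add V'.jet_absorb[OF push_keys[OF u(1)]])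
  qed
  then show ?thesis
    unfolding completion_map_def assms using V.tensor_class_mem_jet[of f k] by blast
qed

text \<open>Over a field, tensoring preserves injectivity: a left inverse of \<open>\<phi>\<close> induces one of
  \<open>\<phi> \<otimes> id\<close>, compatibly with the filtrations.\<close>

lemma inj_completion_map:
  assumes inv: "tensor_hom V' V W Wk \<psi>" "\<And>v. v \<in> carrier V \<Longrightarrow> \<psi> (\<phi> v) = v"
    and c: "c \<in> carrier (completion (tensor V W) (\<lambda>k. tensor_image V W (Wk k)))"
    and d: "d \<in> carrier (completion (tensor V W) (\<lambda>k. tensor_image V W (Wk k)))"
    and eq: "completion_map (tensor V' W) (\<lambda>k. tensor_image V' W (Wk k)) (tensor_map V' W \<phi>) c =
      completion_map (tensor V' W) (\<lambda>k. tensor_image V' W (Wk k)) (tensor_map V' W \<phi>) d"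
  shows "c = d"
proof
  fix k
  interpret inv: tensor_hom V' V W Wk \<psi> by (rule inv(1))
  obtain f where f: "f \<in> V.free" "c k = V.jet k f" using c unfolding V.completion_sel(1) by blast
  obtain g where g: "g \<in> V.free" "d k = V.jet k g" using d unfolding V.completion_sel(1) by blast
  have "V'.jet k (push f) = V'.jet k (push g)"
    using completion_map_jets[of c, OF f(2)] completion_map_jets[of d, OF g(2)] eq by simp
  then obtain u where u: "Poly_Mapping.keys u \<subseteq> carrier V' \<times> Wk k"
      "push f - push g - u \<in> tensor_kernel V' W"
    by (rule V'.jet_eqD)
  have id: "inv.push (push h) = h" if "h \<in> V.free" for h
    unfolding pm_map_comp using that inv(2) by (intro pm_map_ident) fastforce
  \<comment> \<open>The error term u is carried to one whose second factors still lie in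
    \<open>Wk k\<close>; it is absorbed at the same level below.\<close>
  have "inv.push (push f - push g - u) \<in> tensor_kernel V W" by (rule inv.push_kernel[OF u(2)])
  then have "f - (g + inv.push u) \<in> tensor_kernel V W"
    by (simp only: pm_map_minus pm_map_add id[OF f(1)] id[OF g(1)] diff_diff_eq)
  then have "V.jet k f = V.jet k (g + inv.push u)" by (rule V.jet_cong)
  also have "\<dots> = V.jet k g" by (rule V.jet_absorb[OF inv.push_keys[OF u(1)]])
  finally show "c k = d k" using f g by simp
qed

end

section \<open>Holomorphic forms with logarithmic poles\<close>

lemma complex_differentiable_at_const: "complex_differentiable_at (\<lambda>\<xi>. c) \<zeta>"
  unfolding complex_differentiable_at_def by (rule exI[of _ "\<lambda>_. 0"]) simp

lemma complex_differentiable_at_component: "complex_differentiable_at (\<lambda>\<xi>. \<xi> $ i) \<zeta>"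
proof -
  have "((\<lambda>\<xi>. \<xi> $ i) has_derivative (\<lambda>v. v $ i)) (at \<zeta>)"
    by (rule bounded_linear_imp_has_derivative[OF bounded_linear_vec_nth])
  then show ?thesis
    unfolding complex_differentiable_at_def
    by (intro exI[of _ "\<lambda>j. if j = i then 1 else 0"]) (simp add: if_distrib[of "\<lambda>x. x * _"] cong: if_cong)
qed

lemma complex_differentiable_at_add:
  assumes "complex_differentiable_at f \<zeta>" "complex_differentiable_at g \<zeta>"
  shows "complex_differentiable_at (\<lambda>\<xi>. f \<xi> + g \<xi>) \<zeta>"
proof -
  obtain c d where "(f has_derivative (\<lambda>v. \<Sum>i\<in>UNIV. c i * v$i)) (at \<zeta>)"
    "(g has_derivative (\<lambda>v. \<Sum>i\<in>UNIV. d i * v$i)) (at \<zeta>)"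
    using assms unfolding complex_differentiable_at_def by blast
  from has_derivative_add[OF this] show ?thesis
    unfolding complex_differentiable_at_def
    by (intro exI[of _ "\<lambda>i. c i + d i"]) (simp add: distrib_right sum.distrib)
qed

lemma complex_differentiable_at_mult:
  assumes "complex_differentiable_at f \<zeta>" "complex_differentiable_at g \<zeta>"
  shows "complex_differentiable_at (\<lambda>\<xi>. f \<xi> * g \<xi>) \<zeta>"
proof -
  obtain c d where "(f has_derivative (\<lambda>v. \<Sum>i\<in>UNIV. c i * v$i)) (at \<zeta>)"
    "(g has_derivative (\<lambda>v. \<Sum>i\<in>UNIV. d i * v$i)) (at \<zeta>)"
    using assms unfolding complex_differentiable_at_def by blast
  from has_derivative_mult[OF this] show ?thesis
    unfolding complex_differentiable_at_def
    by (intro exI[of _ "\<lambda>i. f \<zeta> * d i + c i * g \<zeta>"])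
      (simp add: distrib_right distrib_left sum.distrib sum_distrib_left sum_distrib_right mult_ac)
qed

lemma complex_differentiable_at_inverse:
  assumes "complex_differentiable_at f \<zeta>" "f \<zeta> \<noteq> 0"
  shows "complex_differentiable_at (\<lambda>\<xi>. inverse (f \<xi>)) \<zeta>"
proof -
  obtain c where "(f has_derivative (\<lambda>v. \<Sum>i\<in>UNIV. c i * v$i)) (at \<zeta>)"
    using assms unfolding complex_differentiable_at_def by blast
  from Deriv.has_derivative_inverse[OF assms(2) this] show ?thesis
    unfolding complex_differentiable_at_def
    by (intro exI[of _ "\<lambda>i. - (inverse (f \<zeta>) * c i * inverse (f \<zeta>))"])
      (simp add: sum_distrib_left sum_distrib_right mult_ac flip: sum_negf)
qed

lemma complex_differentiable_at_diff:
  assumes "complex_differentiable_at f \<zeta>" "complex_differentiable_at g \<zeta>"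
  shows "complex_differentiable_at (\<lambda>\<xi>. f \<xi> - g \<xi>) \<zeta>"
  using complex_differentiable_at_add[OF assms(1)
      complex_differentiable_at_mult[OF complex_differentiable_at_const[of "- 1"] assms(2)]]
  by simp

lemma complex_differentiable_at_divide:
  assumes "complex_differentiable_at f \<zeta>" "complex_differentiable_at g \<zeta>" "g \<zeta> \<noteq> 0"
  shows "complex_differentiable_at (\<lambda>\<xi>. f \<xi> / g \<xi>) \<zeta>"
  using complex_differentiable_at_mult[OF assms(1) complex_differentiable_at_inverse[OF assms(2,3)]]
  by (simp add: divide_inverse)

lemma complex_differentiable_at_transform:
  assumes "complex_differentiable_at f \<zeta>" "open S" "\<zeta> \<in> S" "\<And>\<xi>. \<xi> \<in> S \<Longrightarrow> f \<xi> = g \<xi>"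
  shows "complex_differentiable_at g \<zeta>"
proof -
  obtain c where "(f has_derivative (\<lambda>v. \<Sum>i\<in>UNIV. c i * v$i)) (at \<zeta>)"
    using assms(1) unfolding complex_differentiable_at_def by (rule exE)
  then have "(g has_derivative (\<lambda>v. \<Sum>i\<in>UNIV. c i * v$i)) (at \<zeta>)"
    by (rule has_derivative_transform_within_open[OF _ assms(2-4)])
  then show ?thesis unfolding complex_differentiable_at_def by (intro exI[of _ c])
qed

lemma complex_differentiable_at_isCont: "complex_differentiable_at f \<zeta> \<Longrightarrow> isCont f \<zeta>"
  unfolding complex_differentiable_at_def using has_derivative_continuous by blast

text \<open>Homogeneous coordinates polynomial in the chart coordinate, unlike
  \<open>homog (chart_inv S \<zeta> i)\<close>, which is not continuous where the point becomes
  infinite.\<close>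

definition homog_chart :: "'n set \<Rightarrow> complex^'n \<Rightarrow> 'n \<Rightarrow> complex \<times> complex" where
  "homog_chart S \<zeta> i = (if i \<in> S then (1, \<zeta>$i) else (\<zeta>$i, 1))"

lemma homog_chart_homog:
  obtains c where "c \<noteq> 0" "homog_chart S \<zeta> i = rescale c (homog (chart_inv S \<zeta> i))"
proof (cases "i \<in> S \<and> \<zeta>$i \<noteq> 0")
  case True
  then show thesis by (intro that[of "\<zeta>$i"]) (auto simp: homog_chart_def chart_inv_def rescale_def)
next
  case False
  then show thesis by (intro that[of 1]) (auto simp: homog_chart_def chart_inv_def rescale_def)
qed

lemma wedge_homog_chart_eq_0_iff:
  assumes "c \<noteq> 0"
  shows "wedge (homog_chart S \<zeta> i) (rescale c (homog q)) = 0 \<longleftrightarrow> chart_inv S \<zeta> i = q"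
proof -
  obtain d where "d \<noteq> 0" "homog_chart S \<zeta> i = rescale d (homog (chart_inv S \<zeta> i))" by (rule homog_chart_homog)
  then show ?thesis using assms by (simp add: wedge_homog_eq_0_iff)
qed

text \<open>For v = (z,1), a = (s,1), b = (t,1) this is 1/(z - s) - 1/(z - t). It has degree 0 in a
  and in b, so these matter only as points, and degree -2 in v, which matches the derivative of z ->
  1/z.\<close>

definition dlog_ratio :: "complex \<times> complex \<Rightarrow> complex \<times> complex \<Rightarrow> complex \<times> complex \<Rightarrow> complex" where
  "dlog_ratio v a b = wedge a b / (wedge v a * wedge v b)"

lemma dlog_ratio_rescale1: "c \<noteq> 0 \<Longrightarrow> dlog_ratio (rescale c v) a b = dlog_ratio v a b / c\<^sup>2"
  and dlog_ratio_rescale23: "d \<noteq> 0 \<Longrightarrow> e \<noteq> 0 \<Longrightarrow> dlog_ratio v (rescale d a) (rescale e b) = dlog_ratio v a b"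
  by (simp_all add: dlog_ratio_def power2_eq_square field_simps)

text \<open>The cocycle rule for d log((z - a)/(z - b)); with denominators cleared it is the
  three-term Pluecker relation among four vectors of a plane.\<close>

lemma dlog_ratio_diff:
  assumes "wedge v a \<noteq> 0" "wedge v b \<noteq> 0" "wedge v c \<noteq> 0"
  shows "dlog_ratio v a b = dlog_ratio v a c - dlog_ratio v b c"
proof -
  have "wedge a b * wedge v c = wedge a c * wedge v b - wedge b c * wedge v a"
    by (simp add: wedge_def algebra_simps)
  then show ?thesis using assms by (simp add: dlog_ratio_def divide_simps mult_ac)
qed

text \<open>With \<open>Inf\<close> as second pole the ratio is the ordinary d log(z - q). For q =
  \<open>Inf\<close> its numerator vanishes, which is the convention d log(z - infinity) =
  0.\<close>

lemma dlog_coeff_dlog_ratio: "dlog_coeff z q = dlog_ratio (z, 1) (homog q) (homog Inf)"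
  by (cases q) (simp_all add: dlog_coeff_def dlog_ratio_def wedge_def divide_simps)

text \<open>In homogeneous coordinates the form \<open>d log ((z - a) / (z - b))\<close> is
  \<open>[a, b] (y dx - x dy) / ([v, a] [v, b])\<close> with \<open>z = x / y\<close>, \<open>v = (x, y)\<close>, which makes sense when
  \<open>z\<close>, \<open>a\<close> or \<open>b\<close> is infinite, as long as \<open>z\<close> avoids \<open>a\<close> and \<open>b\<close>. The sign below is that of
  \<open>y dx - x dy\<close> for \<open>v = (1, \<zeta>)\<close> and \<open>v = (\<zeta>, 1)\<close>.\<close>

definition theta :: "('n \<Rightarrow> p1) set \<Rightarrow> 'n \<Rightarrow> (('n \<Rightarrow> p1) \<Rightarrow> p1) \<Rightarrow> (('n \<Rightarrow> p1) \<Rightarrow> p1) \<Rightarrow> 'n::finite form" where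
  "theta Y i a b = (\<lambda>S \<zeta>. if chart_inv S \<zeta> \<in> Y
     then axis i ((if i \<in> S then - 1 else 1) *
       dlog_ratio (homog_chart S \<zeta> i) (homog (a (chart_inv S \<zeta>))) (homog (b (chart_inv S \<zeta>)))) else 0)"

text \<open>Holomorphic dependence of a point of P^1 on the configuration. It is tested on some
  holomorphic homogeneous coordinates because the normalised ones, \<open>homog\<close>, jump at
  \<open>Inf\<close>.\<close>

definition liftable :: "(('n::finite \<Rightarrow> p1) \<Rightarrow> p1) \<Rightarrow> bool" where
  "liftable a \<longleftrightarrow> (\<forall>S. \<exists>\<alpha>.
     (\<forall>\<zeta>. complex_differentiable_at (\<lambda>\<xi>. fst (\<alpha> \<xi>)) \<zeta>) \<and>
     (\<forall>\<zeta>. complex_differentiable_at (\<lambda>\<xi>. snd (\<alpha> \<xi>)) \<zeta>) \<and>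
     (\<forall>\<zeta>. \<exists>c. c \<noteq> 0 \<and> \<alpha> \<zeta> = rescale c (homog (a (chart_inv S \<zeta>)))))"

lemma liftableE:
  fixes a :: "('n::finite \<Rightarrow> p1) \<Rightarrow> p1"
  assumes "liftable a"
  obtains \<alpha> where "\<And>\<zeta>. complex_differentiable_at (\<lambda>\<xi>. fst (\<alpha> \<xi>)) \<zeta>"
    "\<And>\<zeta>. complex_differentiable_at (\<lambda>\<xi>. snd (\<alpha> \<xi>)) \<zeta>"
    "\<And>\<zeta>. \<exists>c. c \<noteq> 0 \<and> \<alpha> \<zeta> = rescale c (homog (a (chart_inv S \<zeta>)))"
  using assms unfolding liftable_def by metis

lemma liftable_const: "liftable (\<lambda>p. q)"
  unfolding liftable_def
  by (intro allI exI[of _ "\<lambda>\<xi>. homog q"] conjI complex_differentiable_at_const exI[of _ 1])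
    (simp_all add: rescale_def)

lemma complex_differentiable_at_homog_chart:
  "complex_differentiable_at (\<lambda>\<xi>. fst (homog_chart S \<xi> i)) \<zeta>" "complex_differentiable_at (\<lambda>\<xi>. snd (homog_chart S \<xi> i)) \<zeta>"
  by (cases "i \<in> S"; simp add: homog_chart_def complex_differentiable_at_const complex_differentiable_at_component)+

lemma liftable_act:
  assumes "g \<in> carrier PSU2"
  shows "liftable (\<lambda>p. psu2_act g (p j))"
proof -
  obtain A where A: "A \<in> carrier SU2" "g = {A, - A}" using PSU2_carrier_cases[OF assms] by blast
  then have det: "det A = 1" and act: "psu2_act g q = homography A q" for q
    using psu2_act_eq[OF assms, of A] by (auto simp: SU2_def)
  show ?thesis
    unfolding liftable_def
  proof (intro allI exI[of _ "\<lambda>\<xi>. mat_apply A (homog_chart _ \<xi> j)"] conjI)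
    fix S \<zeta>
    obtain c where c: "c \<noteq> 0" "homog_chart S \<zeta> j = rescale c (homog (chart_inv S \<zeta> j))" by (rule homog_chart_homog)
    obtain d where d: "d \<noteq> 0" "mat_apply A (homog (chart_inv S \<zeta> j)) = rescale d (homog (homography A (chart_inv S \<zeta> j)))"
      by (rule mat_apply_homog[OF det])
    show "\<exists>c. c \<noteq> 0 \<and> mat_apply A (homog_chart S \<zeta> j) = rescale c (homog (psu2_act g (chart_inv S \<zeta> j)))"
      using c d by (intro exI[of _ "c * d"]) (simp add: act mat_apply_rescale rescale_rescale)
  qed (simp_all add: mat_apply_def complex_differentiable_at_add complex_differentiable_at_mult
      complex_differentiable_at_const complex_differentiable_at_homog_chart)
qed

lemma complex_differentiable_at_wedge:
  assumes "complex_differentiable_at (\<lambda>\<xi>. fst (\<alpha> \<xi>)) \<zeta>" "complex_differentiable_at (\<lambda>\<xi>. snd (\<alpha> \<xi>)) \<zeta>"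
    "complex_differentiable_at (\<lambda>\<xi>. fst (\<beta> \<xi>)) \<zeta>" "complex_differentiable_at (\<lambda>\<xi>. snd (\<beta> \<xi>)) \<zeta>"
  shows "complex_differentiable_at (\<lambda>\<xi>. wedge (\<alpha> \<xi>) (\<beta> \<xi>)) \<zeta>"
  unfolding wedge_def
  by (intro complex_differentiable_at_diff complex_differentiable_at_mult assms)

text \<open>The type \<open>p1\<close> is given no topology; openness is read off in the
  charts.\<close>

definition open_in_charts :: "('n::finite \<Rightarrow> p1) set \<Rightarrow> bool" where
  "open_in_charts Y \<longleftrightarrow> (\<forall>S. open {\<zeta>. chart_inv S \<zeta> \<in> Y})"

text \<open>In each chart the condition is that a continuous function, the \<open>wedge\<close> of
  two lifts, does not vanish.\<close>

lemma open_in_charts_neq: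
  fixes a :: "('n::finite \<Rightarrow> p1) \<Rightarrow> p1"
  assumes "liftable a"
  shows "open_in_charts {p. p i \<noteq> a p}"
  unfolding open_in_charts_def
proof
  fix S
  obtain \<alpha> where \<alpha>: "\<And>\<zeta>. complex_differentiable_at (\<lambda>\<xi>. fst (\<alpha> \<xi>)) \<zeta>"
    "\<And>\<zeta>. complex_differentiable_at (\<lambda>\<xi>. snd (\<alpha> \<xi>)) \<zeta>"
    "\<And>\<zeta>. \<exists>c. c \<noteq> 0 \<and> \<alpha> \<zeta> = rescale c (homog (a (chart_inv S \<zeta>)))"
    using liftableE[OF assms] by metis
  have "chart_inv S \<zeta> i \<noteq> a (chart_inv S \<zeta>) \<longleftrightarrow> wedge (homog_chart S \<zeta> i) (\<alpha> \<zeta>) \<noteq> 0" for \<zeta>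
  proof -
    obtain c where "c \<noteq> 0" "\<alpha> \<zeta> = rescale c (homog (a (chart_inv S \<zeta>)))" using \<alpha>(3) by blast
    then show ?thesis using wedge_homog_chart_eq_0_iff[of c S \<zeta> i] by auto
  qed
  moreover have "isCont (\<lambda>\<zeta>. wedge (homog_chart S \<zeta> i) (\<alpha> \<zeta>)) \<zeta>" for \<zeta>
    by (intro complex_differentiable_at_isCont complex_differentiable_at_wedge \<alpha> complex_differentiable_at_homog_chart)
  then have "open {\<zeta>. wedge (homog_chart S \<zeta> i) (\<alpha> \<zeta>) \<noteq> 0}"
    by (intro open_Collect_neq continuous_intros) (simp add: continuous_at_imp_continuous_on)
  ultimately show "open {\<zeta>. chart_inv S \<zeta> \<in> {p. p i \<noteq> a p}}" by simp
qed

lemma open_in_charts_INT: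
  assumes "finite A" "\<And>a. a \<in> A \<Longrightarrow> open_in_charts (Y a)"
  shows "open_in_charts (\<Inter>a\<in>A. Y a)"
  unfolding open_in_charts_def
proof
  fix S
  have "open (\<Inter>a\<in>A. {\<zeta>. chart_inv S \<zeta> \<in> Y a})"
    using assms by (intro open_INT) (auto simp: open_in_charts_def)
  then show "open {\<zeta>. chart_inv S \<zeta> \<in> (\<Inter>a\<in>A. Y a)}"
    by (simp add: Collect_ball_eq)
qed

lemma open_in_charts_Int:
  assumes "open_in_charts Y" "open_in_charts Z"
  shows "open_in_charts (Y \<inter> Z)"
  using assms by (auto simp: open_in_charts_def Collect_conj_eq)

lemma open_in_charts_Cf:
  assumes G: "subgroup G PSU2" "finite G"
  shows "open_in_charts (Cf G :: ('n::finite \<Rightarrow> p1) set)"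
proof -
  have eq: "Cf G = (\<Inter>i. \<Inter>q\<in>- P1_star G. {p. p i \<noteq> q}) \<inter>
      (\<Inter>i. \<Inter>j\<in>- {i}. \<Inter>g\<in>G. {p :: 'n \<Rightarrow> p1. p i \<noteq> psu2_act g (p j)})"
    by (auto simp: Cf_def)
  show ?thesis
    unfolding eq
    by (intro open_in_charts_Int open_in_charts_INT open_in_charts_neq liftable_const liftable_act)
      (use finite_not_P1_star[OF G] G(2) subgroup.subset[OF G(1)] in auto)
qed

lemma Cf_affine_eq: "Cf_affine G = Cf G \<inter> (\<Inter>i. {p. p i \<noteq> Inf})"
  by (auto simp: Cf_affine_def)

lemma open_in_charts_Cf_affine:
  assumes G: "subgroup G PSU2" "finite G"
  shows "open_in_charts (Cf_affine G :: ('n::finite \<Rightarrow> p1) set)"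
  unfolding Cf_affine_eq
  by (intro open_in_charts_Int open_in_charts_INT open_in_charts_neq liftable_const open_in_charts_Cf[OF G]) auto

lemma chart_inv_inj:
  assumes "chart_inv S \<zeta> = chart_inv T \<xi>" "i \<in> S \<longleftrightarrow> i \<in> T"
  shows "\<zeta>$i = \<xi>$i"
  using fun_cong[OF assms(1), of i] assms(2)
  by (auto simp: chart_inv_def split: if_splits)

lemma chart_inv_inverse:
  assumes "chart_inv S \<zeta> = chart_inv T \<xi>" "(i \<in> S) \<noteq> (i \<in> T)"
  shows "\<zeta>$i \<noteq> 0" "\<xi>$i = 1 / \<zeta>$i"
  using fun_cong[OF assms(1), of i] assms(2)
  by (auto simp: chart_inv_def split: if_splits)

text \<open>Since z_i avoids both poles on Y, neither denominator vanishes, even where z_i or a pole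
  is infinite.\<close>

lemma holomorphic_theta:
  fixes a b :: "('n::finite \<Rightarrow> p1) \<Rightarrow> p1"
  assumes Y: "open_in_charts Y" and a: "liftable a" and b: "liftable b"
    and neq: "\<And>p. p \<in> Y \<Longrightarrow> p i \<noteq> a p \<and> p i \<noteq> b p"
  shows "holomorphic_form Y (theta Y i a b)"
  unfolding holomorphic_form_def
proof (intro conjI allI impI)
  show "theta Y i a b S \<zeta> = 0" if "chart_inv S \<zeta> \<notin> Y" for S \<zeta>
    using that by (simp add: theta_def)
next
  fix S T \<zeta> \<xi> k
  assume *: "chart_inv S \<zeta> \<in> Y \<and> chart_inv S \<zeta> = chart_inv T \<xi>"
  then have eq: "chart_inv S \<zeta> = chart_inv T \<xi>" by blast
  show "theta Y i a b S \<zeta> $ k = theta Y i a b T \<xi> $ k * transition_deriv S T \<zeta> k"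
  proof (cases "i \<in> S \<longleftrightarrow> i \<in> T")
    case True
    then have "homog_chart S \<zeta> i = homog_chart T \<xi> i" using chart_inv_inj[OF eq True] by (simp add: homog_chart_def)
    then show ?thesis
      using * True by (cases "k = i") (simp_all add: theta_def axis_def transition_deriv_def)
  next
    case False
    have nz: "\<zeta>$i \<noteq> 0" "\<xi>$i = 1 / \<zeta>$i" using chart_inv_inverse[OF eq] False by auto
    \<comment> \<open>Degree -2 turns this factor into the inverse square of the coordinate, and the
      sign in \<open>theta\<close> changes between the charts; together they give
      \<open>transition_deriv\<close>.\<close>
    then have "homog_chart S \<zeta> i = rescale (\<zeta>$i) (homog_chart T \<xi> i)" using False by (auto simp: homog_chart_def rescale_def)
    then show ?thesis
      using * False nz(1) by (cases "k = i") (auto simp: theta_def axis_def transition_deriv_def dlog_ratio_rescale1)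
  qed
next
  fix S \<zeta> k
  assume in_Y: "chart_inv S \<zeta> \<in> Y"
  obtain \<alpha> where \<alpha>: "\<And>\<zeta>. complex_differentiable_at (\<lambda>\<xi>. fst (\<alpha> \<xi>)) \<zeta>"
    "\<And>\<zeta>. complex_differentiable_at (\<lambda>\<xi>. snd (\<alpha> \<xi>)) \<zeta>"
    "\<And>\<zeta>. \<exists>c. c \<noteq> 0 \<and> \<alpha> \<zeta> = rescale c (homog (a (chart_inv S \<zeta>)))"
    using liftableE[OF a] by metis
  obtain \<beta> where \<beta>: "\<And>\<zeta>. complex_differentiable_at (\<lambda>\<xi>. fst (\<beta> \<xi>)) \<zeta>"
    "\<And>\<zeta>. complex_differentiable_at (\<lambda>\<xi>. snd (\<beta> \<xi>)) \<zeta>"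
    "\<And>\<zeta>. \<exists>c. c \<noteq> 0 \<and> \<beta> \<zeta> = rescale c (homog (b (chart_inv S \<zeta>)))"
    using liftableE[OF b] by metis
  let ?s = "if i \<in> S then - 1 else 1 :: complex"
  have nz: "wedge (homog_chart S \<zeta> i) (\<alpha> \<zeta>) \<noteq> 0" "wedge (homog_chart S \<zeta> i) (\<beta> \<zeta>) \<noteq> 0"
    using neq[OF in_Y] \<alpha>(3)[of \<zeta>] \<beta>(3)[of \<zeta>] wedge_homog_chart_eq_0_iff[of _ S \<zeta> i] by metis+
  have "complex_differentiable_at (\<lambda>\<xi>. ?s * dlog_ratio (homog_chart S \<xi> i) (\<alpha> \<xi>) (\<beta> \<xi>)) \<zeta>"
    unfolding dlog_ratio_def
    by (intro complex_differentiable_at_mult complex_differentiable_at_divide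
        complex_differentiable_at_wedge complex_differentiable_at_const \<alpha> \<beta> complex_differentiable_at_homog_chart)
      (use nz in simp)
  then have diff: "complex_differentiable_at (\<lambda>\<xi>. if k = i then ?s * dlog_ratio (homog_chart S \<xi> i) (\<alpha> \<xi>) (\<beta> \<xi>) else 0) \<zeta>"
    using complex_differentiable_at_const by (cases "k = i") simp_all
  \<comment> \<open>Degree 0 in the poles lets the holomorphic lifts stand in for
    \<open>homog\<close>.\<close>
  have dlog_ratio: "dlog_ratio (homog_chart S \<xi> i) (\<alpha> \<xi>) (\<beta> \<xi>) = dlog_ratio (homog_chart S \<xi> i) (homog (a (chart_inv S \<xi>))) (homog (b (chart_inv S \<xi>)))" for \<xi>
    using \<alpha>(3)[of \<xi>] \<beta>(3)[of \<xi>] dlog_ratio_rescale23 by metis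
  show "complex_differentiable_at (\<lambda>\<xi>. theta Y i a b S \<xi> $ k) \<zeta>"
  proof (rule complex_differentiable_at_transform[OF diff])
    show "open {\<xi>. chart_inv S \<xi> \<in> Y}" using Y by (simp add: open_in_charts_def)
  qed (use in_Y in \<open>auto simp: theta_def axis_def dlog_ratio\<close>)
qed

lemma theta_diff:
  assumes "\<And>p. p \<in> Y \<Longrightarrow> p i \<noteq> a p \<and> p i \<noteq> b p \<and> p i \<noteq> c p"
  shows "theta Y i a b S \<zeta> = theta Y i a c S \<zeta> - theta Y i b c S \<zeta>"
proof (cases "chart_inv S \<zeta> \<in> Y")
  case True
  have "wedge (homog_chart S \<zeta> i) (homog q) \<noteq> 0" if "chart_inv S \<zeta> i \<noteq> q" for q
    using wedge_homog_chart_eq_0_iff[of 1 S \<zeta> i q] that by (simp add: rescale_def)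
  then have "dlog_ratio (homog_chart S \<zeta> i) (homog (a (chart_inv S \<zeta>))) (homog (b (chart_inv S \<zeta>))) =
      dlog_ratio (homog_chart S \<zeta> i) (homog (a (chart_inv S \<zeta>))) (homog (c (chart_inv S \<zeta>))) -
      dlog_ratio (homog_chart S \<zeta> i) (homog (b (chart_inv S \<zeta>))) (homog (c (chart_inv S \<zeta>)))"
    using assms[OF True] by (intro dlog_ratio_diff) auto
  then show ?thesis
    using True by (simp add: theta_def axis_def vec_eq_iff right_diff_distrib)
qed (simp add: theta_def)

lemma restrict_theta: "Y \<subseteq> X \<Longrightarrow> restrict_form Y (theta X i a b) = theta Y i a b"
  by (auto simp: restrict_form_def theta_def fun_eq_iff)

text \<open>In a chart inverting z_i, passing from the affine coordinate to the chart coordinate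
  rescales v by the latter; the resulting inverse square and sign are those of
  \<open>transition_deriv S {}\<close>.\<close>

lemma affine_form_dlog:
  assumes "\<And>p i. p \<in> Y \<Longrightarrow> p i \<noteq> Inf"
  shows "affine_form Y i (\<lambda>z. dlog_coeff (z$i) (a (\<lambda>j. Fin (z$j)))) = theta Y i a (\<lambda>p. Inf)"
proof (intro ext)
  fix S \<zeta>
  show "affine_form Y i (\<lambda>z. dlog_coeff (z$i) (a (\<lambda>j. Fin (z$j)))) S \<zeta> = theta Y i a (\<lambda>p. Inf) S \<zeta>"
  proof (cases "chart_inv S \<zeta> \<in> Y")
    case True
    let ?w = "\<chi> j. if j \<in> S then 1 / \<zeta>$j else \<zeta>$j"
    have nz: "\<zeta>$j \<noteq> 0" if "j \<in> S" for j
      using assms[OF True, of j] that by (auto simp: chart_inv_def)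
    then have pt: "chart_inv S \<zeta> = (\<lambda>j. Fin (?w$j))"
      by (auto simp: chart_inv_def fun_eq_iff)
    have "dlog_ratio (?w$i, 1) q r * transition_deriv S {} \<zeta> i = (if i \<in> S then - 1 else 1) * dlog_ratio (homog_chart S \<zeta> i) q r" for q r
    proof (cases "i \<in> S")
      case True
      then have "homog_chart S \<zeta> i = rescale (\<zeta>$i) (?w$i, 1)" using nz by (simp add: homog_chart_def rescale_def)
      then show ?thesis using True nz by (simp add: dlog_ratio_rescale1 transition_deriv_def)
    qed (simp add: homog_chart_def transition_deriv_def)
    then show ?thesis
      using True by (simp add: affine_form_def theta_def dlog_coeff_dlog_ratio pt)
  qed (simp add: affine_form_def theta_def)
qed

lemma dlog1_eq_theta:
  assumes "\<And>p i. p \<in> Y \<Longrightarrow> p i \<noteq> Inf"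
  shows "dlog1 Y i q = theta Y i (\<lambda>p. q) (\<lambda>p. Inf)"
  unfolding dlog1_def by (rule affine_form_dlog[of Y i "\<lambda>p. q"]) (rule assms)

lemma dlog2_eq_theta:
  assumes "\<And>p i. p \<in> Y \<Longrightarrow> p i \<noteq> Inf"
  shows "dlog2 Y i j g = theta Y i (\<lambda>p. psu2_act g (p j)) (\<lambda>p. Inf)"
  unfolding dlog2_def by (rule affine_form_dlog[of Y i "\<lambda>p. psu2_act g (p j)"]) (rule assms)

text \<open>Openness of Y keeps the coefficients, which are cut off to 0 outside Y, differentiable
  at the points of Y.\<close>

lemma holomorphic_restrict_form:
  assumes \<eta>: "holomorphic_form X \<eta>" and Y: "Y \<subseteq> X" "open_in_charts Y"
  shows "holomorphic_form Y (restrict_form Y \<eta>)"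
  unfolding holomorphic_form_def
proof (intro conjI allI impI)
  fix S \<zeta> i assume *: "chart_inv S \<zeta> \<in> Y"
  then have "complex_differentiable_at (\<lambda>\<xi>. \<eta> S \<xi> $ i) \<zeta>"
    using \<eta> Y unfolding holomorphic_form_def by blast
  then show "complex_differentiable_at (\<lambda>\<xi>. restrict_form Y \<eta> S \<xi> $ i) \<zeta>"
  proof (rule complex_differentiable_at_transform)
    show "open {\<xi>. chart_inv S \<xi> \<in> Y}" using Y by (simp add: open_in_charts_def)
  qed (use * in \<open>auto simp: restrict_form_def\<close>)
next
  fix S T \<zeta> \<xi> i assume *: "chart_inv S \<zeta> \<in> Y \<and> chart_inv S \<zeta> = chart_inv T \<xi>"
  then have "\<eta> S \<zeta> $ i = \<eta> T \<xi> $ i * transition_deriv S T \<zeta> i"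
    using \<eta> Y unfolding holomorphic_form_def by blast
  then show "restrict_form Y \<eta> S \<zeta> $ i = restrict_form Y \<eta> T \<xi> $ i * transition_deriv S T \<zeta> i"
    using * by (auto simp: restrict_form_def)
qed (simp add: restrict_form_def)

text \<open>The affine part is dense in every chart.\<close>

lemma restrict_form_eq_0:
  fixes \<eta> :: "'n::finite form"
  assumes \<eta>: "holomorphic_form X \<eta>" and X: "open_in_charts X"
    and U: "\<And>p. p \<in> X \<Longrightarrow> (\<And>i. p i \<noteq> Inf) \<Longrightarrow> p \<in> U"
    and zero: "\<And>S \<zeta>. restrict_form U \<eta> S \<zeta> = 0"
  shows "\<eta> S \<zeta> = 0"
proof (cases "chart_inv S \<zeta> \<in> X")
  case True
  \<comment> \<open>Moving along the diagonal makes all coordinates nonzero at once for small t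
    other than 0, hence all points finite whichever coordinates are inverted.\<close>
  define \<gamma> :: "complex \<Rightarrow> complex^'n" where "\<gamma> t = (\<chi> i. \<zeta>$i + t)" for t
  have \<gamma>: "(\<gamma> \<longlongrightarrow> \<zeta>) (at 0)"
  proof (rule vec_tendstoI)
    fix i
    have "((\<lambda>t. \<zeta>$i + t) \<longlongrightarrow> \<zeta>$i + 0) (at 0)" by (intro tendsto_intros)
    then show "((\<lambda>t. \<gamma> t $ i) \<longlongrightarrow> \<zeta>$i) (at 0)" by (simp add: \<gamma>_def)
  qed
  have "\<forall>\<^sub>F t in at 0. \<gamma> t \<in> {\<xi>. chart_inv S \<xi> \<in> X}"
    using \<gamma> True X by (intro topological_tendstoD) (auto simp: open_in_charts_def)
  moreover have "\<forall>\<^sub>F t in at 0. \<forall>i. \<gamma> t $ i \<noteq> 0"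
  proof (rule eventually_all_finite)
    fix i
    show "\<forall>\<^sub>F t in at 0. \<gamma> t $ i \<noteq> 0"
    proof (cases "\<zeta>$i = 0")
      case True
      then show ?thesis by (simp add: \<gamma>_def eventually_at_filter)
    next
      case False
      then show ?thesis using tendsto_vec_nth[OF \<gamma>] by (rule tendsto_imp_eventually_ne[rotated])
    qed
  qed
  ultimately have ev: "\<forall>\<^sub>F t in at 0. \<eta> S (\<gamma> t) = 0"
  proof eventually_elim
    case (elim t)
    then have "chart_inv S (\<gamma> t) \<in> U" by (intro U) (auto simp: chart_inv_def)
    then show ?case using zero[of S "\<gamma> t"] by (simp add: restrict_form_def)
  qed
  have "\<eta> S \<zeta> $ i = 0" for i
  proof -
    have "isCont (\<lambda>\<xi>. \<eta> S \<xi> $ i) \<zeta>"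
      using \<eta> True unfolding holomorphic_form_def by (intro complex_differentiable_at_isCont) blast
    then have "((\<lambda>t. \<eta> S (\<gamma> t) $ i) \<longlongrightarrow> \<eta> S \<zeta> $ i) (at 0)"
      using \<gamma> by (rule isCont_tendsto_compose)
    moreover have "((\<lambda>t. \<eta> S (\<gamma> t) $ i) \<longlongrightarrow> 0) (at 0)"
      by (rule tendsto_eventually) (use ev in eventually_elim, simp)
    ultimately show ?thesis by (intro tendsto_unique[of "at (0::complex)"]) auto
  qed
  then show ?thesis by (simp add: vec_eq_iff)
next
  case False
  then show ?thesis using \<eta> by (simp add: holomorphic_form_def)
qed

section \<open>Existence and uniqueness\<close>

lemma Omega1_sel:
  "carrier (Omega1 X) = {\<eta>. holomorphic_form X \<eta>}"
  "\<eta> \<oplus>\<^bsub>Omega1 X\<^esub> \<theta> = \<eta> + \<theta>"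
  "c \<odot>\<^bsub>Omega1 X\<^esub> \<eta> = (\<lambda>S \<zeta>. c *s \<eta> S \<zeta>)"
  by (simp_all add: Omega1_def fun_eq_iff)

lemma holomorphic_formD:
  assumes "holomorphic_form X \<eta>"
  shows "chart_inv S \<zeta> \<notin> X \<Longrightarrow> \<eta> S \<zeta> = 0"
    "chart_inv S \<zeta> \<in> X \<and> chart_inv S \<zeta> = chart_inv T \<xi> \<Longrightarrow>
      \<eta> S \<zeta> $ i = \<eta> T \<xi> $ i * transition_deriv S T \<zeta> i"
    "chart_inv S \<zeta> \<in> X \<Longrightarrow> complex_differentiable_at (\<lambda>\<xi>. \<eta> S \<xi> $ i) \<zeta>"
  using assms unfolding holomorphic_form_def by blast+

lemma holomorphic_form_add:
  assumes "holomorphic_form X \<eta>" "holomorphic_form X \<theta>"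
  shows "holomorphic_form X (\<eta> + \<theta>)"
  unfolding holomorphic_form_def
proof (intro conjI allI impI)
  fix S T \<zeta> \<xi> i assume *: "chart_inv S \<zeta> \<in> X \<and> chart_inv S \<zeta> = chart_inv T \<xi>"
  show "(\<eta> + \<theta>) S \<zeta> $ i = (\<eta> + \<theta>) T \<xi> $ i * transition_deriv S T \<zeta> i"
    using holomorphic_formD(2)[OF assms(1) *, of i] holomorphic_formD(2)[OF assms(2) *, of i]
    by (simp add: distrib_right)
qed (simp_all add: holomorphic_formD[OF assms(1)] holomorphic_formD[OF assms(2)] complex_differentiable_at_add)

lemma holomorphic_form_smult:
  assumes "holomorphic_form X \<eta>"
  shows "holomorphic_form X (\<lambda>S \<zeta>. c *s \<eta> S \<zeta>)"
  unfolding holomorphic_form_def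
proof (intro conjI allI impI)
  fix S T \<zeta> \<xi> i assume *: "chart_inv S \<zeta> \<in> X \<and> chart_inv S \<zeta> = chart_inv T \<xi>"
  show "(c *s \<eta> S \<zeta>) $ i = (c *s \<eta> T \<xi>) $ i * transition_deriv S T \<zeta> i"
    using holomorphic_formD(2)[OF assms *, of i] by simp
qed (simp_all add: holomorphic_formD[OF assms] complex_differentiable_at_mult complex_differentiable_at_const)

lemma holomorphic_form_0: "holomorphic_form X 0"
  by (simp add: holomorphic_form_def complex_differentiable_at_const)

context graded_space
begin

abbreviation "\<A> \<equiv> graded_completion A Ag"

lemma filtered_tensor_forms: "filtered_tensor (Omega1 X) \<A> (degree_filtration A Ag)"
  by unfold_locales
    (auto simp: Omega1_sel holomorphic_form_add holomorphic_form_smult graded_completion_def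
      degree_filtration_def add_graded smult_graded)

lemma tensor_hom_forms:
  assumes "\<And>\<eta>. \<eta> \<in> carrier (Omega1 X) \<Longrightarrow> \<phi> \<eta> \<in> carrier (Omega1 Y)"
    "\<And>\<eta> \<theta>. \<phi> (\<eta> + \<theta>) = \<phi> \<eta> + \<phi> \<theta>"
    "\<And>c \<eta>. \<phi> (\<lambda>S \<zeta>. c *s \<eta> S \<zeta>) = (\<lambda>S \<zeta>. c *s \<phi> \<eta> S \<zeta>)"
  shows "tensor_hom (Omega1 X) (Omega1 Y) \<A> (degree_filtration A Ag) \<phi>"
  by (intro tensor_hom.intro filtered_tensor_forms tensor_hom_axioms.intro)
    (simp_all add: assms Omega1_sel(2,3))

lemma forms_with_values_eq:
  "forms_with_values X A Ag = completion (tensor (Omega1 X) \<A>)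
     (\<lambda>k. tensor_image (Omega1 X) \<A> (degree_filtration A Ag k))"
  by (simp add: forms_with_values_def forms_filtration_def[abs_def])

end

text \<open>A basis extension in the vector space of all families of coefficient functions,
  holomorphic or not, gives a linear \<psi> on that whole space with holomorphic values. Injectivity
  of restriction on holomorphic forms is density of the affine part.\<close>

lemma restrict_form_left_inverse:
  fixes X U :: "('n::finite \<Rightarrow> p1) set"
  assumes X: "open_in_charts X" and U: "{p \<in> X. \<forall>i. p i \<noteq> Inf} \<subseteq> U"
  obtains \<psi> :: "'n form \<Rightarrow> 'n form"
  where "\<And>\<eta>. \<psi> \<eta> \<in> carrier (Omega1 X)" "\<And>\<eta> \<theta>. \<psi> (\<eta> + \<theta>) = \<psi> \<eta> + \<psi> \<theta>"
    "\<And>c \<eta>. \<psi> (\<lambda>S \<zeta>. c *s \<eta> S \<zeta>) = (\<lambda>S \<zeta>. c *s \<psi> \<eta> S \<zeta>)"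
    "\<And>\<eta>. \<eta> \<in> carrier (Omega1 X) \<Longrightarrow> \<psi> (restrict_form U \<eta>) = \<eta>"
proof -
  define sm :: "complex \<Rightarrow> 'n form \<Rightarrow> 'n form" where "sm c \<eta> = (\<lambda>S \<zeta>. c *s \<eta> S \<zeta>)" for c \<eta>
  interpret vs: vector_space sm
    by unfold_locales (simp_all add: sm_def fun_eq_iff vec_eq_iff algebra_simps)
  interpret vp: vector_space_pair sm sm ..
  have lin: "Vector_Spaces.linear sm sm (restrict_form U)"
    by unfold_locales (simp_all add: sm_def restrict_form_def fun_eq_iff vec_eq_iff)
  have sub: "vs.subspace (carrier (Omega1 X))"
    by (simp add: vs.subspace_def Omega1_sel sm_def holomorphic_form_0 holomorphic_form_add holomorphic_form_smult)
  have inj: "inj_on (restrict_form U) (carrier (Omega1 X))"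
  proof (rule inj_onI)
    fix \<eta> \<theta> :: "'n form"
    assume *: "\<eta> \<in> carrier (Omega1 X)" "\<theta> \<in> carrier (Omega1 X)" "restrict_form U \<eta> = restrict_form U \<theta>"
    have hol: "holomorphic_form X (\<eta> - \<theta>)"
      using vs.subspace_diff[OF sub *(1,2)] by (simp add: Omega1_sel)
    have zero: "restrict_form U (\<eta> - \<theta>) S \<zeta> = 0" for S \<zeta>
      using fun_cong[OF fun_cong[OF *(3)], of S \<zeta>] by (simp add: restrict_form_def split: if_splits)
    have "(\<eta> - \<theta>) S \<zeta> = 0" for S \<zeta>
      by (rule restrict_form_eq_0[OF hol X _ zero]) (use U in blast)
    then show "\<eta> = \<theta>" by (simp add: fun_eq_iff)
  qed
  obtain \<psi> where \<psi>: "\<psi> ` UNIV \<subseteq> carrier (Omega1 X)" "Vector_Spaces.linear sm sm \<psi>"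
    "\<forall>\<eta>\<in>carrier (Omega1 X). \<psi> (restrict_form U \<eta>) = \<eta>"
    using vp.linear_exists_left_inverse_on[OF lin sub inj] by blast
  interpret \<psi>: Vector_Spaces.linear sm sm \<psi> by (rule \<psi>(2))
  show thesis
    by (rule that[of \<psi>]) (use \<psi>(1,3) \<psi>.add \<psi>.scale in \<open>auto simp: sm_def\<close>)
qed

context tensor_space
begin

lemma kernel_add_left:
  assumes "v \<in> carrier V" "v' \<in> carrier V" "w \<in> carrier W"
  shows "basis (v \<oplus>\<^bsub>V\<^esub> v', w) - basis (v, w) - basis (v', w) \<in> tensor_kernel V W"
  by (rule bilinear_relators_kernel, unfold bilinear_relators_def) (use assms in blast)

lemma kernel_add_right:
  assumes "v \<in> carrier V" "w \<in> carrier W" "w' \<in> carrier W"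
  shows "basis (v, w \<oplus>\<^bsub>W\<^esub> w') - basis (v, w) - basis (v, w') \<in> tensor_kernel V W"
  by (rule bilinear_relators_kernel, unfold bilinear_relators_def) (use assms in blast)

end

text \<open>\<open>gens_at G i\<close> are the generators in relation (2) for \<open>i\<close>; the generator \<open>t\<close> is attached to
  the point \<open>pole t\<close>, at which its coefficient has a pole as a function of \<open>z\<^sub>i\<close>.\<close>

definition gens_at :: "psu2 set \<Rightarrow> 'n \<Rightarrow> 'n pgen set" where
  "gens_at G i = {XP i q | q. q \<in> - P1_star G} \<union> {XX i j g | j g. j \<in> - {i} \<and> g \<in> G}"

fun pole :: "'n pgen \<Rightarrow> ('n \<Rightarrow> p1) \<Rightarrow> p1" where
  "pole (XP i q) p = q"
| "pole (XX i j g) p = psu2_act g (p j)"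

lemma pole_eq: "pole (XP i q) = (\<lambda>p. q)" "pole (XX i j g) = (\<lambda>p. psu2_act g (p j))"
  by (simp_all add: fun_eq_iff)

lemma sum_gens_at:
  fixes h :: "'n::finite pgen \<Rightarrow> 'b::comm_monoid_add"
  assumes "finite (- P1_star G)" "finite G"
  shows "sum h (gens_at G i) = (\<Sum>q\<in>- P1_star G. h (XP i q)) + (\<Sum>j\<in>- {i}. \<Sum>g\<in>G. h (XX i j g))"
proof -
  have "gens_at G i = XP i ` (- P1_star G) \<union> (\<lambda>(j, g). XX i j g) ` ((- {i}) \<times> G)"
    by (auto simp: gens_at_def)
  then have "sum h (gens_at G i) = sum h (XP i ` (- P1_star G)) + sum h ((\<lambda>(j, g). XX i j g) ` ((- {i}) \<times> G))"
    using assms by (simp only:) (rule sum.union_disjoint, auto)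
  also have "\<dots> = (\<Sum>q\<in>- P1_star G. h (XP i q)) + (\<Sum>(j, g)\<in>(- {i}) \<times> G. h (XX i j g))"
    by (subst (1 2) sum.reindex) (auto simp: inj_on_def case_prod_unfold)
  finally show ?thesis by (simp add: sum.cartesian_product)
qed

lemma finite_gens_at:
  fixes i :: "'n::finite"
  assumes "finite (- P1_star G)" "finite G"
  shows "finite (gens_at G i)"
proof -
  have "gens_at G i = XP i ` (- P1_star G) \<union> (\<lambda>(j, g). XX i j g) ` ((- {i}) \<times> G)"
    by (auto simp: gens_at_def)
  then show ?thesis using assms by simp
qed

context
  fixes G :: "psu2 set"
  assumes G: "subgroup G PSU2" and finG: "finite G"
begin

lemma liftable_pole:
  fixes t :: "'n::finite pgen"
  assumes "t \<in> gens_at G i"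
  shows "liftable (pole t)"
  using assms subgroup.subset[OF G]
  by (auto simp: gens_at_def pole_eq liftable_const intro!: liftable_act)

lemma Cf_neq_pole: "p \<in> Cf G \<Longrightarrow> t \<in> gens_at G i \<Longrightarrow> p i \<noteq> pole t p"
  by (auto simp: Cf_def gens_at_def)

lemma gens_at_subset: "gens_at G i \<subseteq> pn_gens G"
  by (auto simp: gens_at_def pn_gens_def)

lemma sum_gens_at_relator:
  "(\<Sum>t\<in>gens_at G i. basis (Leaf t)) \<in> (pn_relators G :: ('n::finite pgen magma \<Rightarrow>\<^sub>0 complex) set)"
  unfolding sum_gens_at[OF finite_not_P1_star[OF G finG] finG] pn_relators_def
  \<comment> \<open>Six times \<open>UnI1\<close> and then \<open>UnI2\<close> select the second of
    the eight families of relators.\<close>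
  by (rule UnI1, rule UnI1, rule UnI1, rule UnI1, rule UnI1, rule UnI1, rule UnI2, rule CollectI, rule exI, rule conjI, rule refl) simp

lemma gens_span_sum:
  assumes "S \<subseteq> gens_at G i"
  shows "(\<Sum>t\<in>S. basis (Leaf t)) \<in> gens_span G"
  unfolding gens_span_def[OF G] using assms gens_at_subset[of i]
  by (intro CollectI keys_sum_subset keys_basis_subset imageI) blast

end

lemma ctensor_eq_jet:
  assumes "graded_space A Ag"
  shows "ctensor Y A Ag \<eta> a = (\<lambda>k. filtered_tensor.jet (Omega1 Y) (graded_completion A Ag)
     (degree_filtration A Ag) k (basis (\<eta>, a)))"
  unfolding ctensor_def forms_filtration_def
    filtered_tensor.jet_eq[OF graded_space.filtered_tensor_forms[OF assms]] ..

theorem mainTheorem2: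
  fixes G :: "psu2 set"
  assumes "subgroup G PSU2" and "finite G"
  shows "let X = (Cf G :: ('n::finite \<Rightarrow> p1) set); U = Cf_affine G; \<Omega>U = pn_forms G U in
    \<exists>!\<omega>. \<omega> \<in> carrier (pn_forms G X) \<and>
      pn_restrict G U \<omega> =
        (\<Oplus>\<^bsub>\<Omega>U\<^esub>i\<in>UNIV. \<Oplus>\<^bsub>\<Omega>U\<^esub>p\<in>- P1_star G. pn_ctensor G U (dlog1 U i p) (Upn_gen G (XP i p)))
        \<oplus>\<^bsub>\<Omega>U\<^esub>
        (\<Oplus>\<^bsub>\<Omega>U\<^esub>i\<in>UNIV. \<Oplus>\<^bsub>\<Omega>U\<^esub>j\<in>- {i}. \<Oplus>\<^bsub>\<Omega>U\<^esub>g\<in>G.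
           pn_ctensor G U (dlog2 U i j g) (Upn_gen G (XX i j g)))"
proof -
  note G = assms
  define X where "X = (Cf G :: ('n \<Rightarrow> p1) set)"
  define U where "U = (Cf_affine G :: ('n \<Rightarrow> p1) set)"
  define A where "A = (Upn G :: (complex, 'n Upn) module)"
  define Ag where "Ag = (Upn_graded G :: nat \<Rightarrow> 'n Upn set)"
  have UX: "U \<subseteq> X" by (auto simp: U_def X_def Cf_affine_def)
  have UInf: "p i \<noteq> Inf" if "p \<in> U" for p i using that by (simp add: U_def Cf_affine_def)
  have oX: "open_in_charts X" unfolding X_def by (rule open_in_charts_Cf[OF G])
  have oU: "open_in_charts U" unfolding U_def by (rule open_in_charts_Cf_affine[OF G])
  have finP: "finite (- P1_star G)" by (rule finite_not_P1_star[OF G])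
  have graded: "graded_space A Ag"
    unfolding A_def Ag_def by (rule graded_space_Upn[OF G(1)])
  interpret graded_space A Ag by (rule graded)
  let ?Wk = "degree_filtration A Ag"
  interpret V: filtered_tensor "Omega1 X" \<A> ?Wk by (rule filtered_tensor_forms)
  interpret V': filtered_tensor "Omega1 U" \<A> ?Wk by (rule filtered_tensor_forms)
  have hom: "tensor_hom (Omega1 X) (Omega1 U) \<A> ?Wk (restrict_form U)"
  proof (rule tensor_hom_forms)
    show "restrict_form U \<eta> \<in> carrier (Omega1 U)" if "\<eta> \<in> carrier (Omega1 X)" for \<eta>
      using holomorphic_restrict_form[OF _ UX oU] that by (simp add: Omega1_sel(1))
  qed (auto simp: restrict_form_def fun_eq_iff)
  interpret res: tensor_hom "Omega1 X" "Omega1 U" \<A> ?Wk "restrict_form U" by (rule hom)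
  obtain \<psi> :: "'n form \<Rightarrow> 'n form"
    where \<psi>: "\<And>\<eta>. \<psi> \<eta> \<in> carrier (Omega1 X)" "\<And>\<eta> \<theta>. \<psi> (\<eta> + \<theta>) = \<psi> \<eta> + \<psi> \<theta>"
      "\<And>c \<eta>. \<psi> (\<lambda>S \<zeta>. c *s \<eta> S \<zeta>) = (\<lambda>S \<zeta>. c *s \<psi> \<eta> S \<zeta>)"
      "\<And>\<eta>. \<eta> \<in> carrier (Omega1 X) \<Longrightarrow> \<psi> (restrict_form U \<eta>) = \<eta>"
    by (rule restrict_form_left_inverse[OF oX, of U]) (auto simp: U_def X_def Cf_affine_def)
  have inv: "tensor_hom (Omega1 U) (Omega1 X) \<A> ?Wk \<psi>"
    by (rule tensor_hom_forms) (use \<psi> in auto)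

  define gen where "gen t = Upn_gen G t" for t :: "'n pgen"
  \<comment> \<open>The generator whose pole is subtracted. \<open>gens_at G i\<close> may be empty,
    as for n = 1 and trivial G; then \<open>base i\<close> is arbitrary, but the sums over
    \<open>gens_at G i\<close> are empty too.\<close>
  define base where "base i = (SOME t. t \<in> gens_at G i)" for i :: 'n
  have base: "base i \<in> gens_at G i" if "t \<in> gens_at G i" for t i
    using that unfolding base_def by (rule someI)
  have gen_car: "gen t \<in> carrier \<A>" if "t \<in> gens_at G i" for t i
    unfolding gen_def Upn_gen_eq A_def Ag_def
    using gens_span_sum[OF G, of "{t}" i] that by (intro Upn_lin_carrier[OF G(1)]) simp
  have neqX: "p i \<noteq> pole t p" if "p \<in> X" "t \<in> gens_at G i" for p t i
    using Cf_neq_pole[OF G] that by (simp add: X_def)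
  have neqU: "p i \<noteq> pole t p" if "p \<in> U" "t \<in> gens_at G i" for p t i
    using neqX UX that by blast
  have thX: "theta X i (pole t) (pole (base i)) \<in> carrier (Omega1 X)" if t: "t \<in> gens_at G i" for t i
    unfolding Omega1_sel(1) mem_Collect_eq
    by (rule holomorphic_theta[OF oX liftable_pole[OF G t] liftable_pole[OF G base[OF t]]])
      (intro conjI neqX t base[OF t])
  have thU: "theta U i (pole t) (pole (base i)) \<in> carrier (Omega1 U)" if t: "t \<in> gens_at G i" for t i
    unfolding Omega1_sel(1) mem_Collect_eq
    by (rule holomorphic_theta[OF oU liftable_pole[OF G t] liftable_pole[OF G base[OF t]]])
      (intro conjI neqU t base[OF t])
  have dlogU: "theta U i (pole t) (\<lambda>p. Inf) \<in> carrier (Omega1 U)" if t: "t \<in> gens_at G i" for t i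
    unfolding Omega1_sel(1) mem_Collect_eq
    by (rule holomorphic_theta[OF oU liftable_pole[OF G t] liftable_const]) (intro conjI neqU t UInf)

  \<comment> \<open>\<open>FX\<close> represents the form to be constructed and \<open>FU\<close>
    the prescribed one; they differ in the second pole, which must be avoided on all of X for the
    former and may be \<open>Inf\<close> on U.\<close>
  define FX where "FX = (\<Sum>i\<in>UNIV. \<Sum>t\<in>gens_at G i. basis (theta X i (pole t) (pole (base i)), gen t))"
  define FU where "FU = (\<Sum>i\<in>UNIV. \<Sum>t\<in>gens_at G i. basis (theta U i (pole t) (\<lambda>p. Inf), gen t))"
  have FX: "FX \<in> V.free"
    unfolding FX_def by (intro CollectI keys_sum_subset keys_basis_subset SigmaI thX gen_car)

  \<comment> \<open>Relation (2) after tensoring with a fixed form.\<close>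
  have base_sum: "(\<Sum>t\<in>gens_at G i. basis (\<eta>, gen t)) \<in> tensor_kernel (Omega1 U) \<A>"
    if \<eta>: "\<eta> \<in> carrier (Omega1 U)" for \<eta> and i :: 'n
  proof -
    let ?K = "tensor_kernel (Omega1 U) \<A>"
    note K = subspace_ofD[OF V'.subspace_tensor_kernel]
    let ?l = "\<lambda>S. Upn_lin G (\<Sum>t\<in>S. basis (Leaf t)) :: nat \<Rightarrow> 'n Upn"
    have zero: "basis (\<eta>, \<zero>\<^bsub>\<A>\<^esub>) \<in> ?K"
    proof -
      have z: "\<zero>\<^bsub>\<A>\<^esub> \<in> carrier \<A>" "\<zero>\<^bsub>\<A>\<^esub> \<oplus>\<^bsub>\<A>\<^esub> \<zero>\<^bsub>\<A>\<^esub> = \<zero>\<^bsub>\<A>\<^esub>"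
        by (simp_all add: graded_completion_def zero_graded zero_add_zero)
      \<comment> \<open>The additivity relator for 0 + 0 = 0 is exactly minus this basis
        vector.\<close>
      have "- basis (\<eta>, \<zero>\<^bsub>\<A>\<^esub>) \<in> ?K"
        using V'.kernel_add_right[OF \<eta> z(1) z(1)] by (simp add: z(2))
      then show ?thesis using K(5) by fastforce
    qed
    \<comment> \<open>Subsets are needed for the induction; only the full set of generators gives a
      relator.\<close>
    have "basis (\<eta>, ?l S) - (\<Sum>t\<in>S. basis (\<eta>, gen t)) \<in> ?K" if "finite S" "S \<subseteq> gens_at G i" for S
      using that
    proof (induction S rule: finite_induct)
      case empty
      show ?case using zero by (simp add: Upn_lin_zero[OF G(1)] flip: A_def Ag_def)
    next
      case (insert t S)
      have span: "basis (Leaf t) \<in> gens_span G" "(\<Sum>t\<in>S. basis (Leaf t)) \<in> gens_span G"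
        using gens_span_sum[OF G, of "{t}" i] gens_span_sum[OF G, of S i] insert.prems by simp_all
      have "?l (insert t S) = gen t \<oplus>\<^bsub>\<A>\<^esub> ?l S"
        unfolding gen_def Upn_gen_eq A_def Ag_def using insert.hyps Upn_lin_add[OF G(1) span] by simp
      moreover have "?l S \<in> carrier \<A>"
        unfolding A_def Ag_def by (rule Upn_lin_carrier[OF G(1) span(2)])
      ultimately have "basis (\<eta>, ?l (insert t S)) - basis (\<eta>, gen t) - basis (\<eta>, ?l S) \<in> ?K"
        using V'.kernel_add_right[OF \<eta> gen_car[of t i]] insert.prems by simp
      from K(3)[OF this insert.IH] show ?case
        using insert by (simp add: algebra_simps)
    qed
    from this[of "gens_at G i"] have "basis (\<eta>, ?l (gens_at G i)) - (\<Sum>t\<in>gens_at G i. basis (\<eta>, gen t)) \<in> ?K"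
      using finite_gens_at[OF finP G(2)] by blast
    moreover have "?l (gens_at G i) = \<zero>\<^bsub>\<A>\<^esub>"
      unfolding A_def Ag_def by (rule Upn_lin_relator[OF G(1) sum_gens_at_relator[OF G]])
    ultimately show ?thesis using K(6)[OF zero] by fastforce
  qed

  \<comment> \<open>Modulo the kernel, the i-th parts of \<open>FU\<close> and of the restricted
    \<open>FX\<close> differ by one form, with poles at \<open>base i\<close> and
    \<open>Inf\<close>, tensored with each generator in turn; \<open>base_sum\<close> kills that
    sum.\<close>
  have push_FX: "res.push FX - FU \<in> tensor_kernel (Omega1 U) \<A>"
  proof -
    let ?K = "tensor_kernel (Omega1 U) \<A>"
    note K = subspace_ofD[OF V'.subspace_tensor_kernel]
    have "res.push FX = (\<Sum>i\<in>UNIV. \<Sum>t\<in>gens_at G i. basis (theta U i (pole t) (pole (base i)), gen t))"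
      by (simp add: FX_def pm_map_sum restrict_theta[OF UX])
    then have eq: "res.push FX - FU = - (\<Sum>i\<in>UNIV. \<Sum>t\<in>gens_at G i.
        basis (theta U i (pole t) (\<lambda>p. Inf), gen t) - basis (theta U i (pole t) (pole (base i)), gen t))"
      by (simp add: FU_def sum_subtractf)
    have "(\<Sum>t\<in>gens_at G i. basis (theta U i (pole t) (\<lambda>p. Inf), gen t) -
        basis (theta U i (pole t) (pole (base i)), gen t)) \<in> ?K" for i
    proof (cases "gens_at G i = {}")
      case True
      then show ?thesis using K(2) by simp
    next
      case False
      let ?e = "theta U i (pole (base i)) (\<lambda>p. Inf)"
      have b: "base i \<in> gens_at G i" using False base by blast
      have e: "?e \<in> carrier (Omega1 U)" by (rule dlogU[OF b])
      have "basis (theta U i (pole t) (\<lambda>p. Inf), gen t) -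
          basis (theta U i (pole t) (pole (base i)), gen t) - basis (?e, gen t) \<in> ?K"
        if t: "t \<in> gens_at G i" for t
      proof -
        have neq: "p i \<noteq> pole t p \<and> p i \<noteq> pole (base i) p \<and> p i \<noteq> Inf" if "p \<in> U" for p
          using that UInf neqU[OF _ t] neqU[OF _ b] by blast
        have "theta U i (pole t) (\<lambda>p. Inf) = theta U i (pole t) (pole (base i)) + ?e"
          using theta_diff[of U i "pole t" "pole (base i)" "\<lambda>p. Inf", OF neq]
          by (simp add: fun_eq_iff)
        then show ?thesis
          using V'.kernel_add_left[OF thU[OF t] e gen_car[OF t]] by (simp add: Omega1_sel)
      qed
      then have "(\<Sum>t\<in>gens_at G i. basis (theta U i (pole t) (\<lambda>p. Inf), gen t) -
          basis (theta U i (pole t) (pole (base i)), gen t) - basis (?e, gen t)) \<in> ?K"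
        by (rule subspace_of_sum[OF V'.subspace_tensor_kernel])
      from K(3)[OF this base_sum[OF e, of i]] show ?thesis
        by (simp only: sum_subtractf diff_add_cancel)
    qed
    then show ?thesis
      unfolding eq by (rule K(5)[OF subspace_of_sum[OF V'.subspace_tensor_kernel]])
  qed

  define \<omega> where "\<omega> = (\<lambda>k. V.jet k FX)"
  define rhs where "rhs = (\<lambda>k. V'.jet k FU)"
  have \<omega>: "\<omega> \<in> carrier (forms_with_values X A Ag)"
    unfolding \<omega>_def forms_with_values_eq by (rule V.jets_carrier[OF FX])
  have restrict_eq: "restrict_values U A Ag = completion_map (tensor (Omega1 U) \<A>)
      (\<lambda>k. tensor_image (Omega1 U) \<A> (?Wk k)) (tensor_map (Omega1 U) \<A> (restrict_form U))"
    by (simp add: restrict_values_def forms_filtration_def[abs_def])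
  have restrict_\<omega>: "restrict_values U A Ag \<omega> = rhs"
  proof
    fix k
    have "restrict_values U A Ag \<omega> k = V'.jet k (res.push FX)"
      unfolding restrict_eq by (rule res.completion_map_jets) (simp add: \<omega>_def)
    also have "\<dots> = rhs k" unfolding rhs_def by (rule V'.jet_cong[OF push_FX])
    finally show "restrict_values U A Ag \<omega> k = rhs k" .
  qed
  have unique: "\<omega>1 = \<omega>2"
    if "\<omega>1 \<in> carrier (forms_with_values X A Ag)" "\<omega>2 \<in> carrier (forms_with_values X A Ag)"
      "restrict_values U A Ag \<omega>1 = restrict_values U A Ag \<omega>2" for \<omega>1 \<omega>2
    by (rule res.inj_completion_map[OF inv \<psi>(4) that[unfolded forms_with_values_eq restrict_eq]])

  let ?O = "forms_with_values U A Ag"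
  have dlog1: "dlog1 U i q = theta U i (\<lambda>p. q) (\<lambda>p. Inf)" for i q
    by (rule dlog1_eq_theta) (rule UInf)
  have dlog2: "dlog2 U i j g = theta U i (\<lambda>p. psu2_act g (p j)) (\<lambda>p. Inf)" for i j g
    by (rule dlog2_eq_theta) (rule UInf)
  have jet1: "ctensor U A Ag (dlog1 U i q) (Upn_gen G (XP i q)) =
      (\<lambda>k. V'.jet k (basis (theta U i (pole (XP i q)) (\<lambda>p. Inf), gen (XP i q))))" for i q
    by (simp add: ctensor_eq_jet[OF graded] dlog1 pole_eq gen_def)
  have jet2: "ctensor U A Ag (dlog2 U i j g) (Upn_gen G (XX i j g)) =
      (\<lambda>k. V'.jet k (basis (theta U i (pole (XX i j g)) (\<lambda>p. Inf), gen (XX i j g))))" for i j g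
    by (simp add: ctensor_eq_jet[OF graded] dlog2 pole_eq gen_def)
  have free: "basis (theta U i (pole t) (\<lambda>p. Inf), gen t) \<in> V'.free" if "t \<in> gens_at G i" for t i
    by (intro CollectI keys_basis_subset SigmaI dlogU[OF that] gen_car[OF that])
  have free1: "basis (theta U i (pole (XP i q)) (\<lambda>p. Inf), gen (XP i q)) \<in> V'.free" if "q \<in> - P1_star G" for i q
    by (rule free) (use that in \<open>auto simp: gens_at_def\<close>)
  have free2: "basis (theta U i (pole (XX i j g)) (\<lambda>p. Inf), gen (XX i j g)) \<in> V'.free"
    if "j \<in> - {i}" "g \<in> G" for i j g
    by (rule free) (use that in \<open>auto simp: gens_at_def\<close>)
  \<comment> \<open>The index type is left variable so that one fact serves sums over points,
    indices and group elements.\<close>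
  have free_sum: "sum h B \<in> V'.free" if "\<And>b. b \<in> B \<Longrightarrow> h b \<in> V'.free"
    for h :: "'b \<Rightarrow> 'n form \<times> (nat \<Rightarrow> 'n Upn) \<Rightarrow>\<^sub>0 complex" and B
    by (rule CollectI, rule keys_sum_subset, drule that, simp only: mem_Collect_eq)
  have sum1: "(\<Oplus>\<^bsub>?O\<^esub>i\<in>UNIV. \<Oplus>\<^bsub>?O\<^esub>q\<in>- P1_star G. ctensor U A Ag (dlog1 U i q) (Upn_gen G (XP i q))) =
      (\<lambda>k. V'.jet k (\<Sum>i\<in>UNIV. \<Sum>q\<in>- P1_star G. basis (theta U i (pole (XP i q)) (\<lambda>p. Inf), gen (XP i q))))"
    unfolding forms_with_values_eq jet1
    by (intro V'.finsum_eq_jets V'.finsum_jets finite free_sum free1 finP) auto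
  have sum2: "(\<Oplus>\<^bsub>?O\<^esub>i\<in>UNIV. \<Oplus>\<^bsub>?O\<^esub>j\<in>- {i}. \<Oplus>\<^bsub>?O\<^esub>g\<in>G. ctensor U A Ag (dlog2 U i j g) (Upn_gen G (XX i j g))) =
      (\<lambda>k. V'.jet k (\<Sum>i\<in>UNIV. \<Sum>j\<in>- {i}. \<Sum>g\<in>G.
         basis (theta U i (pole (XX i j g)) (\<lambda>p. Inf), gen (XX i j g))))"
    unfolding forms_with_values_eq jet2
    by (intro V'.finsum_eq_jets V'.finsum_jets finite free_sum free2 G(2)) auto
  \<comment> \<open>For each i the two families of terms together run once through
    \<open>gens_at G i\<close>.\<close>
  have rhs_eq: "(\<Oplus>\<^bsub>?O\<^esub>i\<in>UNIV. \<Oplus>\<^bsub>?O\<^esub>q\<in>- P1_star G. ctensor U A Ag (dlog1 U i q) (Upn_gen G (XP i q)))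
      \<oplus>\<^bsub>?O\<^esub>
      (\<Oplus>\<^bsub>?O\<^esub>i\<in>UNIV. \<Oplus>\<^bsub>?O\<^esub>j\<in>- {i}. \<Oplus>\<^bsub>?O\<^esub>g\<in>G. ctensor U A Ag (dlog2 U i j g) (Upn_gen G (XX i j g))) = rhs"
    unfolding sum1 sum2
    unfolding forms_with_values_eq V'.completion_sel(3) V'.jet_add rhs_def FU_def
    by (simp only: sum_gens_at[OF finP G(2)] sum.distrib)
  have "\<exists>!\<omega>. \<omega> \<in> carrier (forms_with_values X A Ag) \<and> restrict_values U A Ag \<omega> = rhs"
  proof (rule ex1I[of _ \<omega>])
    show "\<omega> \<in> carrier (forms_with_values X A Ag) \<and> restrict_values U A Ag \<omega> = rhs"
      using \<omega> restrict_\<omega> by (rule conjI)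
    show "\<omega>' = \<omega>" if "\<omega>' \<in> carrier (forms_with_values X A Ag) \<and> restrict_values U A Ag \<omega>' = rhs" for \<omega>'
      by (rule unique) (use that \<omega> restrict_\<omega> in simp_all)
  qed
  then show ?thesis
    unfolding Let_def rhs_eq[symmetric] unfolding X_def U_def A_def Ag_def .
qed

end
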